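(* The following hold, where all counts are the exact numbers of codes up to equivalence. (i) There are $404$ inequivalent binary optimal LCD $[15s,4]$ codes with dual distances $d^\perp\ge 2$ for every integer $s\ge 3$. (ii) Suppose that $t\in\{1,6\}$. Then there are $10$ inequivalent binary optimal LCD $[15s+t,4]$ codes with dual distances $d^\perp\ge 2$ for every integer $s\ge 2$ if $t=1$ and for every integer $s\ge 1$ if $t=6$. (iii) Suppose that $t\in\{2,4,8,13\}$. Then there are $2$ inequivalent binary optimal LCD $[15s+t,4]$ codes with dual distances $d^\perp\ge 2$ for every integer $s\ge 1$ if $t\in\{2,4,8\}$ and for every integer $s\ge 0$ if $t=13$. (iv) There are $39$ inequivalent binary optimal LCD $[15s+3,4]$ codes with dual distances $d^\perp\ge 2$ for every integer $s\ge 2$. (v) Suppose that $t\in\{5,9\}$. Then there is a unique binary optimal LCD $[15s+t,4]$ code with dual distance $d^\perp\ge 2$, up to equivalence, for every integer $s\ge 2$. (vi) There are $121$ inequivalent binary optimal LCD $[15s+7,4]$ codes with dual distances $d^\perp\ge 2$ for every integer $s\ge 2$. (vii) There are $11$ inequivalent binary optimal LCD $[15s+10,4]$ codes with dual distances $d^\perp\ge 2$ for every integer $s\ge 1$. (viii) There are $151$ inequivalent binary optimal LCD $[15s+11,4]$ codes with dual distances $d^\perp\ge 2$ for every integer $s\ge 2$. (ix) There are $9$ inequivalent binary optimal LCD $[15s+12,4]$ codes with dual distances $d^\perp\ge 2$ for every integer $s\ge 1$. (x) There are $33$ inequivalent binary optimal LCD $[15s+14,4]$ codes with dual distances $d^\perp\ge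 2$ for every integer $s\ge 1$.
   Context: A binary $[n,k]$ code is a $k$-dimensional subspace $C$ of $\mathbb{F}_2^n$; an $[n,k,d]$ code is one whose minimum weight (the smallest Hamming weight of a nonzero codeword) is exactly $d$. The dual code is $C^\perp=\{x\in\mathbb{F}_2^n: x\cdot y=0 \text{ for all } y\in C\}$ for the standard inner product. $C$ is LCD (linear complementary dual) if $C\cap C^\perp=\{0\}$. The dual distance $d^\perp$ of $C$ is the minimum weight of $C^\perp$. Two binary $[n,k]$ codes are equivalent if one is obtained from the other by a permutation of coordinates. Let $d_2(n,k)$ be the largest $d$ such that a binary LCD $[n,k,d]$ code exists; an LCD $[n,k,d_2(n,k)]$ code is called optimal. (One has, for $n\ge 4$, $d_2(n,4)=\lfloor 8n/15\rfloor$ if $n\equiv 5,9,13\pmod{15}$, $d_2(n,4)=\lfloor 8n/15\rfloor-2$ if $n\equiv 0\pmod{15}$, and $d_2(n,4)=\lfloor 8n/15\rfloor-1$ otherwise.) *)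

theory Defs
  imports
    "HOL-Library.Z2"
    "HOL-Combinatorics.Permutations"
    "Jordan_Normal_Form.VS_Connect"
begin

text \<open>
  The field with two elements is \<^typ>\<open>bit\<close>; a word of length \<open>n\<close> is an element of
  \<open>carrier_vec n :: bit vec set\<close>, with coordinates indexed by \<open>{..<n}\<close>.
\<close>

definition binary_code :: "nat \<Rightarrow> nat \<Rightarrow> bit vec set \<Rightarrow> bool" where
  "binary_code n k C \<longleftrightarrow>
     VectorSpace.subspace class_ring C (module_vec TYPE(bit) n) \<and>
     vectorspace.dim class_ring ((module_vec TYPE(bit) n)\<lparr>carrier := C\<rparr>) = k"

definition hamming_weight :: "bit vec \<Rightarrow> nat" where
  "hamming_weight x = card {i. i < dim_vec x \<and> x $ i \<noteq> 0}"

text \<open>The minimum weight is meaningful only for codes that have a nonzero word.\<close>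

definition min_weight :: "nat \<Rightarrow> bit vec set \<Rightarrow> nat" where
  "min_weight n C = Min {hamming_weight x | x. x \<in> C \<and> x \<noteq> 0\<^sub>v n}"

definition dual_code :: "nat \<Rightarrow> bit vec set \<Rightarrow> bit vec set" where
  "dual_code n C = vec_module.orthogonal_complement n C"

definition dual_distance :: "nat \<Rightarrow> bit vec set \<Rightarrow> nat" where
  "dual_distance n C = min_weight n (dual_code n C)"

definition LCD :: "nat \<Rightarrow> bit vec set \<Rightarrow> bool" where
  "LCD n C \<longleftrightarrow> C \<inter> dual_code n C = {0\<^sub>v n}"

definition LCD_code :: "nat \<Rightarrow> nat \<Rightarrow> nat \<Rightarrow> bit vec set \<Rightarrow> bool" where
  "LCD_code n k d C \<longleftrightarrow> binary_code n k C \<and> min_weight n C = d \<and> LCD n C"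

text \<open>The largest minimum weight of a binary LCD code, meaningful for \<open>1 \<le> k \<le> n\<close>.\<close>

definition d2 :: "nat \<Rightarrow> nat \<Rightarrow> nat" where
  "d2 n k = Max {d. \<exists>C. LCD_code n k d C}"

definition optimal_LCD_code :: "nat \<Rightarrow> nat \<Rightarrow> bit vec set \<Rightarrow> bool" where
  "optimal_LCD_code n k C \<longleftrightarrow> LCD_code n k (d2 n k) C"

definition permute_coords :: "nat \<Rightarrow> (nat \<Rightarrow> nat) \<Rightarrow> bit vec \<Rightarrow> bit vec" where
  "permute_coords n \<pi> x = vec n (\<lambda>i. x $ \<pi> i)"

definition code_equiv :: "nat \<Rightarrow> nat \<Rightarrow> (bit vec set \<times> bit vec set) set" where
  "code_equiv n k = {(C, D). binary_code n k C \<and> binary_code n k D \<and>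
     (\<exists>\<pi>. \<pi> permutes {..<n} \<and> D = permute_coords n \<pi> ` C)}"

text \<open>The optimality and dual distance conditions are invariant under \<^const>\<open>code_equiv\<close>,
  so each class in the quotient consists of codes satisfying them.\<close>

definition num_optimal_LCD :: "nat \<Rightarrow> nat \<Rightarrow> nat" where
  "num_optimal_LCD n k =
     card ({C. optimal_LCD_code n k C \<and> dual_distance n C \<ge> 2} // code_equiv n k)"

end

theory Submission
  imports Defs "HOL-Library.Product_Plus" "HOL-Algebra.Group_Action"
begin

text \<open>
Let \<open>C\<close> be a four-dimensional binary code. Since \<open>wt (x + y) = wt x + wt y - 2 |x \<inter> y|\<close>, the weight modulo 4
is a quadratic form on \<open>C\<close> with values in the integers modulo 4, and its polar form is the inner product.
So \<open>C\<close> is LCD if and only if this form is nondegenerate. A nondegenerate form of this kind has a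
symplectic or an orthonormal basis; in dimension four this leaves six normal forms, which are told
apart by how often they take each value (\<open>normal_form\<close>, \<open>normal_form_unique\<close>).

Suppose that no coordinate of \<open>C\<close> vanishes identically, which is what dual distance at least 2 means, and
that all nonzero words have weight at least \<open>D\<close>. Choose coordinates on \<open>C\<close> in which the weight modulo 4 is a
normal form \<open>p\<close>. The word with coordinates \<open>a \<noteq> 0\<close> then has weight \<open>D + r a + 4 * f a\<close>, where \<open>r a\<close> in \<open>{0..3}\<close>
is the residue of \<open>p a - D\<close> and \<open>f a\<close> is a natural number. Each coordinate is nonzero on eight words, so
the weights add up to \<open>8 * n\<close>, and the sum of \<open>f\<close> is determined by \<open>n\<close>, \<open>D\<close> and \<open>p\<close>.
Conversely every \<open>f\<close> with this sum occurs (\<open>exists_columns_with_weights\<close>): the number of times that a point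
occurs as a column of a generator matrix is an explicit linear function of the weights,
which is an integer because the sums of \<open>p\<close> over complements of hyperplanes are divisible by 4,
and which is nonnegative once \<open>n\<close> is large enough. For the same reason the weights determine
the columns up to order, so two such codes are equivalent if and only if a linear bijection takes
one weight function to the other (\<open>code_equiv_imp_wt\<close>, \<open>wt_imp_code_equiv\<close>). Hence the classes of codes correspond
to pairs of a normal form \<open>p\<close> and an orbit of the isometry group of \<open>p\<close> on the functions \<open>f\<close> with the given
sum (\<open>num_optimal_LCD_eq_class_total\<close>).

Put \<open>E = 8 * n - 15 * D\<close>. Then \<open>E\<close> is the sum of the \<open>r a + 4 * f a\<close>. If \<open>n\<close> grows by 15 and \<open>D\<close> by 8, then neither
\<open>E\<close> nor the residue of \<open>D\<close> modulo 4 changes, so each residue class of \<open>n\<close> modulo 15 gives a single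
number. The orbits are counted by Burnside's lemma from the cycle types of the isometries on
the fifteen nonzero points; the six groups have orders 72, 120, 24, 12, 8 and 12. The same sum shows
that \<open>D\<close> is the largest minimum weight: with \<open>D + 1\<close> in place of \<open>D\<close> the residues alone exceed what
the sum of the weights permits (\<open>no_larger_minimum_weight\<close>).
\<close>

section \<open>Points and linear maps\<close>

(* Statements about points quantify over points, not over their four coordinates. *)
declare split_paired_All [simp del] split_paired_Ex [simp del]

type_synonym pt = "bit \<times> bit \<times> bit \<times> bit"

definition points :: "pt list" where
  "points = List.product [0,1] (List.product [0,1] (List.product [0,1] [0,1]))"

definition nonzero_points :: "pt list" where
  "nonzero_points = filter (\<lambda>a. a \<noteq> 0) points"

lemma UNIV_bit: "(UNIV :: bit set) = {0, 1}"
  using bit.exhaust by auto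

lemma set_points: "set points = UNIV"
proof -
  have "(a, b, c, d) \<in> set points" for a b c d
    by (cases a; cases b; cases c; cases d) (simp_all add: points_def)
  then show ?thesis by auto
qed

lemma set_nonzero_points: "set nonzero_points = - {0}"
  by (auto simp: nonzero_points_def set_points)

lemma distinct_points: "distinct points"
  by (simp add: points_def distinct_product)

lemma distinct_nonzero_points: "distinct nonzero_points"
  by (simp add: nonzero_points_def distinct_points)

lemma card_UNIV_pt: "card (UNIV :: pt set) = 16"
  using distinct_card[OF distinct_points] unfolding set_points by (simp add: points_def)

instance bit :: finite
  by standard (simp add: UNIV_bit)

lemma bit_add_self [simp]: "x + x = (0::bit)"
  by (cases x) auto

lemma pt_add_self [simp]: "a + a = (0::pt)"
  by (cases a) (simp add: zero_prod_def)

lemma pt_add_self_left [simp]: "a + (a + b) = (b::pt)"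
  unfolding add.assoc[symmetric] by simp

lemma pt_add_eq_0_iff: "a + b = (0::pt) \<longleftrightarrow> a = b"
proof
  assume "a + b = 0"
  then have "a + (a + b) = a" by (simp only: add_0_right)
  then show "a = b" by simp
qed simp

text \<open>Over the field with two elements additivity is linearity.\<close>

definition additive_map :: "(pt \<Rightarrow> 'b::ab_group_add) \<Rightarrow> bool" where
  "additive_map \<phi> \<longleftrightarrow> (\<forall>a b. \<phi> (a + b) = \<phi> a + \<phi> b)"

lemma additive_map_add: "additive_map \<phi> \<Longrightarrow> \<phi> (a + b) = \<phi> a + \<phi> b"
  unfolding additive_map_def by blast

lemma additive_map_0: assumes "additive_map \<phi>" shows "\<phi> 0 = 0"
  using additive_map_add[OF assms, of 0 0] by simp

definition GL4 :: "(pt \<Rightarrow> pt) set" where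
  "GL4 = {\<phi>. additive_map \<phi> \<and> bij \<phi>}"

fun lin :: "pt \<times> pt \<times> pt \<times> pt \<Rightarrow> pt \<Rightarrow> pt" where
  "lin (v1, v2, v3, v4) (a, b, c, d) =
     (if a = 1 then v1 else 0) + (if b = 1 then v2 else 0) + (if c = 1 then v3 else 0) + (if d = 1 then v4 else 0)"

lemma if_bit_add: "(if a + b = (1::bit) then v else (0::pt)) = (if a = 1 then v else 0) + (if b = 1 then v else 0)"
  by (cases a; cases b) auto

lemma additive_map_lin: "additive_map (lin v)"
  unfolding additive_map_def
  by (cases v) (auto simp: if_bit_add ac_simps)

text \<open>The four images of the unit vectors determine a linear map; this makes the linear group enumerable.\<close>

lemma additive_map_eq_lin:
  assumes "additive_map \<phi>"
  shows "\<phi> = lin (\<phi> (1,0,0,0), \<phi> (0,1,0,0), \<phi> (0,0,1,0), \<phi> (0,0,0,1))"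
proof
  fix a :: pt
  obtain x y z w where a: "a = (x, y, z, w)" by (cases a)
  have *: "(x, y, z, w) = (if x = 1 then (1,0,0,0) else 0) + (if y = 1 then (0,1,0,0) else 0)
      + (if z = 1 then (0,0,1,0) else 0) + (if w = 1 then (0,0,0,1) else 0)"
    by (auto simp: zero_prod_def)
  show "\<phi> a = lin (\<phi> (1,0,0,0), \<phi> (0,1,0,0), \<phi> (0,0,1,0), \<phi> (0,0,0,1)) a"
    unfolding a by (subst *) (simp add: additive_map_add[OF assms] additive_map_0[OF assms])
qed

lemma lin_basis: "lin (v1,v2,v3,v4) (1,0,0,0) = v1" "lin (v1,v2,v3,v4) (0,1,0,0) = v2"
  "lin (v1,v2,v3,v4) (0,0,1,0) = v3" "lin (v1,v2,v3,v4) (0,0,0,1) = v4"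
  by simp_all

lemma inj_lin: "inj lin"
  by (rule injI) (metis lin_basis prod_cases4)

lemma additive_map_inj_iff:
  assumes "additive_map (\<phi> :: pt \<Rightarrow> pt)" shows "inj \<phi> \<longleftrightarrow> (\<forall>a. \<phi> a = 0 \<longrightarrow> a = 0)"
proof
  assume "inj \<phi>" then show "\<forall>a. \<phi> a = 0 \<longrightarrow> a = 0" by (metis injD additive_map_0[OF assms])
next
  assume *: "\<forall>a. \<phi> a = 0 \<longrightarrow> a = 0"
  show "inj \<phi>"
  proof (rule injI)
    fix a b assume "\<phi> a = \<phi> b"
    then have "\<phi> (a + b) = 0" by (simp add: additive_map_add[OF assms])
    then show "a = b" using * pt_add_eq_0_iff by blast
  qed
qed

lemma GL4_I: "additive_map \<phi> \<Longrightarrow> (\<And>a. \<phi> a = 0 \<Longrightarrow> a = 0) \<Longrightarrow> \<phi> \<in> GL4"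
  unfolding GL4_def using additive_map_inj_iff[of \<phi>] finite_UNIV_inj_surj[of \<phi>] by (simp add: bij_def)

lemma GL4_comp: "\<phi> \<in> GL4 \<Longrightarrow> \<psi> \<in> GL4 \<Longrightarrow> \<phi> o \<psi> \<in> GL4"
  by (auto simp: GL4_def additive_map_def intro: bij_comp)

lemma GL4_id: "id \<in> GL4" by (auto simp: GL4_def additive_map_def)

lemma GL4_inv: assumes "\<phi> \<in> GL4" shows "inv_into UNIV \<phi> \<in> GL4"
proof -
  have b: "bij \<phi>" and l: "additive_map \<phi>" using assms by (auto simp: GL4_def)
  have "inv_into UNIV \<phi> (a + b) = inv_into UNIV \<phi> a + inv_into UNIV \<phi> b" for a b
    by (rule inv_f_eq) (use b l in \<open>auto simp: bij_def additive_map_add surj_f_inv_f\<close>)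
  then show ?thesis using b by (auto simp: GL4_def additive_map_def bij_imp_bij_inv)
qed

lemma GL4_eq_0_iff: "\<phi> \<in> GL4 \<Longrightarrow> \<phi> a = 0 \<longleftrightarrow> a = 0"
  unfolding GL4_def by (metis (mono_tags, lifting) bij_is_inj additive_map_inj_iff additive_map_0 mem_Collect_eq)

definition dot :: "pt \<Rightarrow> pt \<Rightarrow> bit" where
  "dot = (\<lambda>(a, b, c, d) (x, y, z, w). a * x + b * y + c * z + d * w)"

lemma dot_unfold: "dot (a, b, c, d) (x, y, z, w) = a * x + b * y + c * z + d * w"
  by (simp only: dot_def prod.case)

lemma dot_commute: "dot a b = dot b a"
  by (cases a; cases b) (simp add: dot_def ac_simps)

lemma dot_add_left: "dot (a + b) c = dot a c + dot b c"
  by (cases a; cases b; cases c) (simp only: dot_def prod.case add_Pair distrib_right distrib_left ac_simps)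

lemma dot_add_right: "dot c (a + b) = dot c a + dot c b"
  by (metis dot_add_left dot_commute)

lemma dot_0 [simp]: "dot 0 a = 0" "dot a 0 = 0"
  by (cases a; simp add: dot_def zero_prod_def)+

lemma dot_eq_0_imp: assumes "\<And>a. dot a x = 0" shows "x = 0"
proof -
  obtain x1 x2 x3 x4 where x: "x = (x1, x2, x3, x4)" by (cases x)
  show ?thesis using assms[of "(1,0,0,0)"] assms[of "(0,1,0,0)"] assms[of "(0,0,1,0)"] assms[of "(0,0,0,1)"]
    by (simp add: x dot_def zero_prod_def)
qed

definition transpose_map :: "(pt \<Rightarrow> pt) \<Rightarrow> pt \<Rightarrow> pt" where
  "transpose_map \<phi> y = (dot (\<phi> (1,0,0,0)) y, dot (\<phi> (0,1,0,0)) y, dot (\<phi> (0,0,1,0)) y, dot (\<phi> (0,0,0,1)) y)"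

text \<open>The transpose turns a change of coordinates on a code into a change of the columns of its generator matrix.\<close>

lemma dot_transpose:
  assumes "additive_map \<phi>" shows "dot a (transpose_map \<phi> y) = dot (\<phi> a) y"
proof -
  obtain a1 a2 a3 a4 where a: "a = (a1, a2, a3, a4)" by (cases a)
  have 1: "a * dot v y = dot (if a = 1 then v else 0) y" for a v by (cases a) auto
  have "dot (\<phi> a) y = dot (lin (\<phi> (1,0,0,0), \<phi> (0,1,0,0), \<phi> (0,0,1,0), \<phi> (0,0,0,1)) a) y"
    by (rule arg_cong[where f = "\<lambda>v. dot v y"], rule fun_cong[OF additive_map_eq_lin[OF assms]])
  also have "\<dots> = dot a (transpose_map \<phi> y)"
    by (simp only: a lin.simps dot_add_left transpose_map_def dot_unfold 1)
  finally show ?thesis ..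
qed

section \<open>Quadratic forms with values modulo 4\<close>

type_synonym form_data = "bool \<times> int \<times> int \<times> int \<times> int"
text \<open>The form takes the values \<open>u1\<close>, \<open>u2\<close>, \<open>u3\<close>, \<open>u4\<close> at the unit vectors. The Boolean records the inner products: the unit
vectors are orthonormal if it is false; if it is true, the basis is symplectic, with
the first two and the last two unit vectors paired.\<close>

definition form :: "form_data \<Rightarrow> pt \<Rightarrow> int" where
  "form = (\<lambda>(s, u1, u2, u3, u4) (a, b, c, d).
     (u1 * of_bool (a = 1) + u2 * of_bool (b = 1) + u3 * of_bool (c = 1) + u4 * of_bool (d = 1) +
      (if s then 2 * (of_bool (a = 1 \<and> b = 1) + of_bool (c = 1 \<and> d = 1)) else 0)) mod 4)"

text \<open>The first two forms take even values only and are twice the quadratic forms of plus and minus type over the field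
with two elements. The others are diagonal. The diagonal form with four entries 3 is missing
because the words of weight 3 in the orthonormal basis of the form with four entries 1 are again
orthonormal, and the form takes the value 3 at them.\<close>

definition normal_forms :: "form_data list" where
  "normal_forms = [(True,0,0,0,0),(True,0,0,2,2),(False,1,1,1,1),(False,1,1,1,3),(False,1,1,3,3),(False,1,3,3,3)]"

text \<open>The values of \<open>q\<close> matter modulo 4 only. The bilinear form is determined by \<open>q\<close>, but its
bilinearity is an additional requirement.\<close>

locale nondegenerate_form =
  fixes q :: "pt \<Rightarrow> int" and \<beta> :: "pt \<Rightarrow> pt \<Rightarrow> bit"
  assumes q_add: "q (a + b) mod 4 = (q a + q b + 2 * of_bool (\<beta> a b = 1)) mod 4"
    and add_left: "\<beta> (a + b) c = \<beta> a c + \<beta> b c"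
    and sym: "\<beta> a b = \<beta> b a"
    and nondegenerate: "a \<noteq> 0 \<Longrightarrow> \<exists>b. \<beta> a b = 1"
begin

lemma add_right: "\<beta> c (a + b) = \<beta> c a + \<beta> c b"
  by (metis add_left sym)

lemma zero [simp]: "\<beta> 0 a = 0" "\<beta> a 0 = 0"
  using add_left[of 0 0 a] by (simp_all add: sym)

lemma bilinear_if: "\<beta> (if P then v else 0) a = (if P then \<beta> v a else 0)"
  "\<beta> a (if P then v else 0) = (if P then \<beta> a v else 0)"
  by simp_all

lemma q_0: "q 0 mod 4 = 0"
  using q_add[of 0 0] by simp presburger

lemma parity: "q a mod 2 = of_bool (\<beta> a a = 1)"
proof -
  have "(q a + q a + 2 * of_bool (\<beta> a a = 1)) mod 4 = 0"
    using q_add[of a a] q_0 by simp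
  then show ?thesis by (cases "\<beta> a a = 1") (simp; presburger)+
qed

lemma of_bool_bit_add: "(of_bool (x + y = (1::bit)) :: int) = of_bool (x = 1) + of_bool (y = 1) - 2 * of_bool (x = 1 \<and> y = 1)"
  by (cases x; cases y) auto

lemma q_addE: obtains k where "q (a + b) = q a + q b + 2 * of_bool (\<beta> a b = 1) + 4 * k"
proof -
  have "4 dvd q (a + b) - (q a + q b + 2 * of_bool (\<beta> a b = 1))"
    using q_add by (simp only: mod_eq_dvd_iff)
  then obtain k where "q (a + b) - (q a + q b + 2 * of_bool (\<beta> a b = 1)) = 4 * k" by (elim dvdE)
  then show ?thesis by (intro that[of k]) linarith
qed

lemma q_sum4:
  "q (x1 + x2 + x3 + x4) mod 4 =
    (q x1 + q x2 + q x3 + q x4 + 2 * (of_bool (\<beta> x1 x2 = 1) + of_bool (\<beta> x1 x3 = 1) + of_bool (\<beta> x1 x4 = 1)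
      + of_bool (\<beta> x2 x3 = 1) + of_bool (\<beta> x2 x4 = 1) + of_bool (\<beta> x3 x4 = 1))) mod 4" (is "_ = ?r mod 4")
proof -
  obtain k1 k2 k3 where "q (x1 + x2 + x3 + x4) = q (x1 + x2 + x3) + q x4 + 2 * of_bool (\<beta> (x1 + x2 + x3) x4 = 1) + 4 * k1"
    "q (x1 + x2 + x3) = q (x1 + x2) + q x3 + 2 * of_bool (\<beta> (x1 + x2) x3 = 1) + 4 * k2"
    "q (x1 + x2) = q x1 + q x2 + 2 * of_bool (\<beta> x1 x2 = 1) + 4 * k3"
    by (metis q_addE)
  then have "q (x1 + x2 + x3 + x4) = ?r + 4 * (k1 + k2 + k3 - of_bool (\<beta> x1 x4 + \<beta> x2 x4 = 1 \<and> \<beta> x3 x4 = 1)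
      - of_bool (\<beta> x1 x4 = 1 \<and> \<beta> x2 x4 = 1) - of_bool (\<beta> x1 x3 = 1 \<and> \<beta> x2 x3 = 1))"
    unfolding add_left of_bool_bit_add by (simp only: ring_distribs)
  then show ?thesis by (simp only: mod_mult_self2)
qed

text \<open>In a basis whose Gram matrix is the identity or consists of two hyperbolic blocks, \<open>q\<close> is one of the forms above.\<close>

lemma pullback_form:
  assumes "\<beta> v1 v2 = of_bool s" "\<beta> v3 v4 = of_bool s" "\<beta> v1 v3 = 0" "\<beta> v1 v4 = 0" "\<beta> v2 v3 = 0" "\<beta> v2 v4 = 0"
  shows "q (lin (v1, v2, v3, v4) a) mod 4 = form (s, q v1 mod 4, q v2 mod 4, q v3 mod 4, q v4 mod 4) a"
proof -
  obtain a1 a2 a3 a4 where a: "a = (a1, a2, a3, a4)" by (cases a)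
  have if_mod: "q (if P then v else 0) mod 4 = q v mod 4 * of_bool P" for P v using q_0 by simp
  have sum_mod: "(x1 + x2 + x3 + x4 + y) mod 4 = (x1 mod 4 + x2 mod 4 + x3 mod 4 + x4 mod 4 + y) mod 4"
    for x1 x2 x3 x4 y :: int
  proof -
    have "4 dvd (x1 - x1 mod 4) + (x2 - x2 mod 4) + (x3 - x3 mod 4) + (x4 - x4 mod 4)"
      by (intro dvd_add dvd_minus_mod)
    then show ?thesis unfolding mod_eq_dvd_iff by (simp add: algebra_simps)
  qed
  show ?thesis unfolding a lin.simps q_sum4 form_def prod.case
    by (subst sum_mod, unfold if_mod bilinear_if assms, cases a1; cases a2; cases a3; cases a4; cases s) simp_all
qed

lemma lin_in_GL4_orthogonal:
  assumes "\<beta> v1 v2 = 0" "\<beta> v3 v4 = 0" "\<beta> v1 v3 = 0" "\<beta> v1 v4 = 0" "\<beta> v2 v3 = 0" "\<beta> v2 v4 = 0"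
    "\<beta> v1 v1 = 1" "\<beta> v2 v2 = 1" "\<beta> v3 v3 = 1" "\<beta> v4 v4 = 1"
  shows "lin (v1, v2, v3, v4) \<in> GL4"
proof (rule GL4_I[OF additive_map_lin])
  fix a assume 0: "lin (v1, v2, v3, v4) a = 0"
  obtain a1 a2 a3 a4 where a: "a = (a1, a2, a3, a4)" by (cases a)
  have "\<beta> (lin (v1, v2, v3, v4) a) v = 0" for v using 0 by simp
  from this[of v1] this[of v2] this[of v3] this[of v4] show "a = 0"
    using assms by (auto simp: a add_left bilinear_if sym[of v2 v1] sym[of v3 v1] sym[of v3 v2] sym[of v4 v1] sym[of v4 v2] sym[of v4 v3]
        zero_prod_def split: if_splits)
qed

text \<open>The second pair of vectors spans a hyperbolic plane; the first pair is orthonormal for \<open>s = 0\<close> and spans a second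
hyperbolic plane for \<open>s = 1\<close>. In all cases the Gram matrix is invertible, so the vectors are independent.\<close>

lemma lin_in_GL4_mixed:
  assumes "\<beta> v1 v2 = s" "\<beta> v3 v4 = 1" "\<beta> v1 v3 = 0" "\<beta> v1 v4 = 0" "\<beta> v2 v3 = 0" "\<beta> v2 v4 = 0"
    "\<beta> v1 v1 = 1 + s" "\<beta> v2 v2 = 1 + s" "\<beta> v3 v3 = 0" "\<beta> v4 v4 = 0"
  shows "lin (v1, v2, v3, v4) \<in> GL4"
proof (rule GL4_I[OF additive_map_lin])
  fix a assume 0: "lin (v1, v2, v3, v4) a = 0"
  obtain a1 a2 a3 a4 where a: "a = (a1, a2, a3, a4)" by (cases a)
  have "\<beta> (lin (v1, v2, v3, v4) a) v = 0" for v using 0 by simp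
  from this[of v1] this[of v2] this[of v3] this[of v4] show "a = 0"
    using assms by (cases s) (auto simp: a add_left bilinear_if sym[of v2 v1] sym[of v3 v1] sym[of v3 v2] sym[of v4 v1] sym[of v4 v2] sym[of v4 v3]
        zero_prod_def split: if_splits)
qed

text \<open>This replaces dimension counts below: a vector orthogonal to four independent vectors is zero.\<close>

lemma orthogonal_to_basis: assumes "lin (v1, v2, v3, v4) \<in> GL4" "\<beta> x v1 = 0" "\<beta> x v2 = 0" "\<beta> x v3 = 0" "\<beta> x v4 = 0"
  shows "x = 0"
proof (rule ccontr)
  assume "x \<noteq> 0"
  then obtain y where y: "\<beta> x y = 1" using nondegenerate by blast
  obtain a where "y = lin (v1, v2, v3, v4) a" using assms(1) unfolding GL4_def by (metis (mono_tags) bij_pointE mem_Collect_eq)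
  then show False using y assms(2-5)
    by (cases a) (auto simp: add_right bilinear_if split: if_splits)
qed

lemma exists_outside: assumes "card (set xs) < 16" shows "\<exists>y::pt. y \<notin> set xs"
  using assms card_UNIV_pt by (metis UNIV_eq_I less_irrefl)

lemma card_set_le: "length xs < 16 \<Longrightarrow> card (set xs) < 16"
  using card_length[of xs] by linarith

text \<open>A vector and a partner with inner product 1 span a hyperbolic plane. Projection to its orthogonal complement
supplies a second hyperbolic plane.\<close>

lemma symplectic_basis:
  assumes even: "\<And>a. \<beta> a a = 0"
  shows "\<exists>v1 v2 v3 v4. \<beta> v1 v2 = 1 \<and> \<beta> v3 v4 = 1 \<and> \<beta> v1 v3 = 0 \<and> \<beta> v1 v4 = 0 \<and> \<beta> v2 v3 = 0 \<and> \<beta> v2 v4 = 0"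
proof -
  obtain v2 where 12: "\<beta> (1,0,0,0) v2 = 1" using nondegenerate[of "(1,0,0,0)"] by (auto simp: zero_prod_def)
  define v1 :: pt where "v1 = (1,0,0,0)"
  note 12 = 12[folded v1_def]
  define pr where "pr y = y + (if \<beta> y v2 = 1 then v1 else 0) + (if \<beta> y v1 = 1 then v2 else 0)" for y
  have pr: "\<beta> (pr y) v1 = 0" "\<beta> (pr y) v2 = 0" for y
    using 12 even by (auto simp: pr_def add_left sym[of v2 v1])
  have pr_orth: "\<beta> x (pr y) = \<beta> x y" if "\<beta> x v1 = 0" "\<beta> x v2 = 0" for x y
    using that by (simp add: pr_def add_right)
  obtain y where y: "y \<notin> set [0, v1, v2, v1 + v2]" using exists_outside[OF card_set_le, of "[0, v1, v2, v1 + v2]"] by auto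
  have "pr y \<noteq> 0" using y by (auto simp: pr_def pt_add_eq_0_iff add.assoc split: if_splits)
  then obtain z where z: "\<beta> (pr y) z = 1" using nondegenerate by blast
  show ?thesis
    using 12 pr[of y] pr[of z] z pr_orth[of "pr y" z] by (intro exI[of _ v1] exI[of _ v2] exI[of _ "pr y"] exI[of _ "pr z"]) (simp add: sym)
qed

end

context nondegenerate_form
begin

text \<open>The Gram-Schmidt process works as long as the orthogonal complement of the vectors found so far contains a vector with
inner product 1 with itself. If the complement of the first vector or of the first three contained none,
one would find four independent vectors that are all orthogonal to a nonzero vector. If the complement of
the first two contains none, it is a hyperbolic plane with basis \<open>x\<close>, \<open>z\<close>, and \<open>v2\<close> is replaced:
the vectors \<open>v2 + x\<close>, \<open>v2 + z\<close>, \<open>v2 + x + z\<close> are orthonormal.\<close>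

lemma orthonormal_basis:
  assumes v1: "\<beta> v1 v1 = 1"
  shows "\<exists>v1 v2 v3 v4. \<beta> v1 v2 = 0 \<and> \<beta> v3 v4 = 0 \<and> \<beta> v1 v3 = 0 \<and> \<beta> v1 v4 = 0 \<and> \<beta> v2 v3 = 0 \<and> \<beta> v2 v4 = 0 \<and>
    \<beta> v1 v1 = 1 \<and> \<beta> v2 v2 = 1 \<and> \<beta> v3 v3 = 1 \<and> \<beta> v4 v4 = 1"
proof -
  define p1 where "p1 y = y + (if \<beta> y v1 = 1 then v1 else 0)" for y
  have p1: "\<beta> (p1 y) v1 = 0" for y
    using v1 by (simp add: p1_def add_left)
  have p1_orth: "\<beta> x (p1 y) = \<beta> x y" if "\<beta> x v1 = 0" for x y
    using that by (simp add: p1_def add_right)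
  obtain v2 where v2: "\<beta> v2 v1 = 0" "\<beta> v2 v2 = 1"
  proof (rule ccontr)
    assume "\<not> thesis"
    then have alt: "\<beta> x x = 0" if "\<beta> x v1 = 0" for x using that \<open>\<And>v2. \<beta> v2 v1 = 0 \<Longrightarrow> \<beta> v2 v2 = 1 \<Longrightarrow> thesis\<close> by fastforce
    obtain y where y: "y \<notin> set [0, v1]" using exists_outside[OF card_set_le, of "[0, v1]"] by auto
    define x where "x = p1 y"
    have "x \<noteq> 0" using y by (auto simp: x_def p1_def pt_add_eq_0_iff split: if_splits)
    then obtain z where z: "\<beta> x z = 1" using nondegenerate by blast
    define z' where "z' = p1 z"
    have x: "\<beta> x v1 = 0" "\<beta> x x = 0" using p1 alt by (auto simp: x_def)
    have z': "\<beta> z' v1 = 0" "\<beta> z' z' = 0" using p1 alt by (auto simp: z'_def)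
    have xz': "\<beta> x z' = 1" "\<beta> z' x = 1" using p1_orth[OF x(1)] z by (auto simp: z'_def sym[of "p1 z" x])
    define ps where "ps y = p1 y + ((if \<beta> y z' = 1 then x else 0) + (if \<beta> y x = 1 then z' else 0))" for y
    have ps: "\<beta> (ps y) v1 = 0" "\<beta> (ps y) x = 0" "\<beta> (ps y) z' = 0" for y
      using p1[of y] x z' xz' by (simp_all add: ps_def p1_def add_left sym[of v1 x] sym[of v1 z'])
    have ps_orth: "\<beta> t (ps y) = \<beta> t y" if "\<beta> t v1 = 0" "\<beta> t x = 0" "\<beta> t z' = 0" for t y
      using that by (simp add: ps_def p1_def add_right)
    let ?S = "[0, v1, x, z', v1 + x, v1 + z', x + z', v1 + (x + z')]"
    obtain u where u: "u \<notin> set ?S" using exists_outside[OF card_set_le, of ?S] by auto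
    have "ps u \<noteq> 0" using u by (auto simp: ps_def p1_def pt_add_eq_0_iff add.assoc split: if_splits)
    then obtain w where w: "\<beta> (ps u) w = 1" using nondegenerate by blast
    (* A second hyperbolic plane in the complement of \<open>v1\<close> would leave no room for \<open>v1\<close> itself. *)
    have "lin (x, z', ps u, ps w) \<in> GL4"
      using lin_in_GL4_mixed[of x z' 1 "ps u" "ps w"] x z' xz' ps[of u] ps[of w] alt[OF ps(1)] w ps_orth[of "ps u" w]
      by (simp add: sym[of x "ps u"] sym[of x "ps w"] sym[of z' "ps u"] sym[of z' "ps w"])
    then have "v1 = 0"
      by (rule orthogonal_to_basis) (simp_all add: sym[of v1] x z' ps)
    then show False using v1 by simp
  qed
  define p2 where "p2 y = y + ((if \<beta> y v1 = 1 then v1 else 0) + (if \<beta> y v2 = 1 then v2 else 0))" for y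
  have p2: "\<beta> (p2 y) v1 = 0" "\<beta> (p2 y) v2 = 0" for y
    using v1 v2 by (simp_all add: p2_def add_left sym[of v1 v2])
  have p2_orth: "\<beta> x (p2 y) = \<beta> x y" if "\<beta> x v1 = 0" "\<beta> x v2 = 0" for x y
    using that by (simp add: p2_def add_right)
  show ?thesis
  proof (cases "\<exists>v3. \<beta> v3 v1 = 0 \<and> \<beta> v3 v2 = 0 \<and> \<beta> v3 v3 = 1")
    case True
    then obtain v3 where v3: "\<beta> v3 v1 = 0" "\<beta> v3 v2 = 0" "\<beta> v3 v3 = 1" by blast
    define p3 where "p3 y = p2 y + (if \<beta> y v3 = 1 then v3 else 0)" for y
    have p3: "\<beta> (p3 y) v1 = 0" "\<beta> (p3 y) v2 = 0" "\<beta> (p3 y) v3 = 0" for y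
      using p2[of y] v3 by (simp_all add: p3_def add_left) (simp add: p2_def add_left sym[of v1 v3] sym[of v2 v3] v3)
    have p3_orth: "\<beta> x (p3 y) = \<beta> x y" if "\<beta> x v1 = 0" "\<beta> x v2 = 0" "\<beta> x v3 = 0" for x y
      using that p2_orth by (simp add: p3_def add_right)
    let ?S = "[0, v1, v2, v3, v1 + v2, v1 + v3, v2 + v3, v1 + (v2 + v3)]"
    obtain u where u: "u \<notin> set ?S" using exists_outside[OF card_set_le, of ?S] by auto
    have "p3 u \<noteq> 0" using u by (auto simp: p3_def p2_def pt_add_eq_0_iff add.assoc split: if_splits)
    then obtain w where w: "\<beta> (p3 u) w = 1" using nondegenerate by blast
    have "\<exists>v4. \<beta> v4 v1 = 0 \<and> \<beta> v4 v2 = 0 \<and> \<beta> v4 v3 = 0 \<and> \<beta> v4 v4 = 1"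
    proof (rule ccontr)
      assume no: "\<not> ?thesis"
      then have alt: "\<beta> (p3 y) (p3 y) = 0" for y using p3[of y] by fastforce
      (* A hyperbolic plane in the complement of the three vectors would leave no room for \<open>v3\<close>. *)
      have "lin (v1, v2, p3 u, p3 w) \<in> GL4"
        using lin_in_GL4_mixed[of v1 v2 0 "p3 u" "p3 w"] v1 v2 p3[of u] p3[of w] alt w p3_orth[of "p3 u" w]
        by (simp add: sym[of v1 "p3 u"] sym[of v1 "p3 w"] sym[of v2 "p3 u"] sym[of v2 "p3 w"] sym[of v1 v2])
      then have "v3 = 0"
        by (rule orthogonal_to_basis) (simp_all add: sym[of v3 "p3 u"] sym[of v3 "p3 w"] v3 p3)
      then show False using v3 by simp
    qed
    then show ?thesis using v1 v2 v3 sym by metis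
  next
    case False
    then have alt: "\<beta> (p2 y) (p2 y) = 0" for y using p2[of y] by fastforce
    let ?S = "[0, v1, v2, v1 + v2]"
    obtain u where u: "u \<notin> set ?S" using exists_outside[OF card_set_le, of ?S] by auto
    define x where "x = p2 u"
    have "x \<noteq> 0" using u by (auto simp: x_def p2_def pt_add_eq_0_iff add.assoc split: if_splits)
    then obtain w where w: "\<beta> x w = 1" using nondegenerate by blast
    define z where "z = p2 w"
    have x: "\<beta> x v1 = 0" "\<beta> x v2 = 0" "\<beta> x x = 0" using p2 alt by (auto simp: x_def)
    have z: "\<beta> z v1 = 0" "\<beta> z v2 = 0" "\<beta> z z = 0" using p2 alt by (auto simp: z_def)
    have xz: "\<beta> x z = 1" "\<beta> z x = 1" using p2_orth[OF x(1,2)] w by (auto simp: z_def sym[of "p2 w" x])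
    note rev = x(1,2)[unfolded sym[of x]] z(1,2)[unfolded sym[of z]] v2(1)[unfolded sym[of v2]]
    show ?thesis
      by (rule exI[of _ v1], rule exI[of _ "v2 + x"], rule exI[of _ "v2 + z"], rule exI[of _ "v2 + (x + z)"])
        (simp add: add_left add_right v1 v2 x z xz rev)
  qed
qed

end
text \<open>Bases that take the 16 symplectic and the 16 diagonal forms to normal forms. Most of them permute the unit vectors
or change a hyperbolic plane to one in which the values are arranged as in the normal form.\<close>

definition reduction_bases :: "(pt \<times> pt \<times> pt \<times> pt) list" where
  "reduction_bases =
    [((1,0,0,0), (0,1,0,0), (0,0,1,0), (0,0,0,1)), ((1,0,1,1), (0,1,1,1), (1,1,1,0), (1,1,0,1)),
     ((0,0,1,0), (1,0,0,0), (0,0,0,1), (0,1,0,0)), ((0,0,0,1), (0,1,0,0), (0,0,1,0), (1,0,0,0)),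
     ((1,0,0,0), (1,1,0,0), (0,0,1,0), (0,0,0,1)), ((0,1,0,0), (1,1,0,0), (0,0,1,0), (0,0,0,1)),
     ((0,0,1,0), (1,0,0,1), (0,1,1,0), (1,1,1,0)), ((1,0,1,0), (0,1,1,0), (0,0,1,0), (1,1,0,1)),
     ((1,0,0,0), (0,1,0,0), (0,0,0,1), (0,0,1,1)), ((1,0,0,0), (1,1,0,0), (0,0,1,0), (0,0,1,1)),
     ((1,0,0,0), (1,1,0,0), (0,0,0,1), (0,0,1,1)), ((1,0,0,0), (0,0,0,1), (0,1,0,0), (0,0,1,0)),
     ((0,1,0,0), (1,1,0,0), (0,0,0,1), (0,0,1,1)), ((0,1,0,0), (0,0,1,0), (1,0,0,0), (0,0,0,1))]"

text \<open>The pair \<open>(i, j)\<close> says that the form becomes normal form number \<open>j\<close> in basis number \<open>i\<close>.\<close>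

definition reduces :: "form_data \<Rightarrow> nat \<times> nat \<Rightarrow> bool" where
  "reduces p = (\<lambda>(i, j). list_all (\<lambda>a. lin (reduction_bases ! i) a \<noteq> 0) nonzero_points \<and>
     j < 6 \<and> map (\<lambda>a. form p (lin (reduction_bases ! i) a)) points = map (form (normal_forms ! j)) points)"

definition symplectic_data :: "form_data list" where
  "symplectic_data = List.product [True] (List.product [0,2] (List.product [0,2] (List.product [0,2] [0,2])))"

definition diagonal_data :: "form_data list" where
  "diagonal_data = List.product [False] (List.product [1,3] (List.product [1,3] (List.product [1,3] [1,3])))"

lemma reduces_symplectic: "list_all2 reduces symplectic_data
  [(0,0), (7,0), (8,0), (0,1), (4,0), (9,0), (10,0), (4,1), (5,0), (6,0), (12,0), (5,1), (1,1), (6,1), (7,1), (1,0)]"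
  by code_simp

lemma reduces_diagonal: "list_all2 reduces diagonal_data
  [(0,2), (0,3), (1,3), (0,4), (2,3), (2,4), (11,4), (0,5), (3,3), (13,4), (3,4), (1,5), (1,4), (2,5), (3,5), (1,2)]"
  by code_simp

lemma reduces_imp:
  assumes "list_all2 reduces ps xs" "p \<in> set ps"
  shows "\<exists>p'\<in>set normal_forms. \<exists>\<phi>\<in>GL4. \<forall>a. form p (\<phi> a) = form p' a"
proof -
  obtain i j where ij: "reduces p (i, j)"
    using assms unfolding list_all2_conv_all_nth in_set_conv_nth by (metis surj_pair)
  then have "lin (reduction_bases ! i) a \<noteq> 0" if "a \<noteq> 0" for a
    using that set_nonzero_points by (auto simp: reduces_def list_all_iff)
  then have "lin (reduction_bases ! i) \<in> GL4" using GL4_I[OF additive_map_lin] by blast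
  moreover have "form p (lin (reduction_bases ! i) a) = form (normal_forms ! j) a" for a
    using ij set_points by (auto simp: reduces_def map_eq_conv)
  moreover have "normal_forms ! j \<in> set normal_forms" using ij nth_mem[of j normal_forms] by (simp add: reduces_def normal_forms_def[THEN arg_cong[where f = length]])
  ultimately show ?thesis by blast
qed

theorem (in nondegenerate_form) normal_form:
  "\<exists>p\<in>set normal_forms. \<exists>\<phi>\<in>GL4. \<forall>a. q (\<phi> a) mod 4 = form p a"
proof -
  have "\<exists>p\<in>set symplectic_data \<union> set diagonal_data. \<exists>\<phi>\<in>GL4. \<forall>a. q (\<phi> a) mod 4 = form p a"
  proof (cases "\<exists>a. \<beta> a a = 1")
    case True
    then obtain v1 v2 v3 v4 where v: "\<beta> v1 v2 = 0" "\<beta> v3 v4 = 0" "\<beta> v1 v3 = 0" "\<beta> v1 v4 = 0" "\<beta> v2 v3 = 0" "\<beta> v2 v4 = 0"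
      and odd: "\<beta> v1 v1 = 1" "\<beta> v2 v2 = 1" "\<beta> v3 v3 = 1" "\<beta> v4 v4 = 1"
      using orthonormal_basis by meson
    have "q x mod 4 \<in> {1, 3}" if "\<beta> x x = 1" for x
    proof -
      have "q x mod 4 mod 2 = 1" using parity[of x] that by (simp add: mod_mod_cancel)
      moreover have "0 \<le> q x mod 4" "q x mod 4 < 4" by auto
      ultimately show ?thesis by (auto elim!: oddE simp flip: odd_iff_mod_2_eq_one)
    qed
    then have "(False, q v1 mod 4, q v2 mod 4, q v3 mod 4, q v4 mod 4) \<in> set diagonal_data"
      using odd unfolding diagonal_data_def set_product mem_Sigma_iff by simp
    moreover have "\<forall>a. q (lin (v1, v2, v3, v4) a) mod 4 = form (False, q v1 mod 4, q v2 mod 4, q v3 mod 4, q v4 mod 4) a"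
      using pullback_form[of v1 v2 False v3 v4] v by (simp del: lin.simps)
    ultimately show ?thesis using lin_in_GL4_orthogonal[OF v odd] by blast
  next
    case False
    then have even: "\<beta> a a = 0" for a by auto
    then obtain v1 v2 v3 v4 where v: "\<beta> v1 v2 = 1" "\<beta> v3 v4 = 1" "\<beta> v1 v3 = 0" "\<beta> v1 v4 = 0" "\<beta> v2 v3 = 0" "\<beta> v2 v4 = 0"
      using symplectic_basis by meson
    have "q x mod 4 \<in> {0, 2}" for x
    proof -
      have "q x mod 4 mod 2 = 0" using parity[of x] even by (simp add: mod_mod_cancel)
      moreover have "0 \<le> q x mod 4" "q x mod 4 < 4" by auto
      ultimately show ?thesis by (auto elim!: evenE simp flip: even_iff_mod_2_eq_zero)
    qed
    then have "(True, q v1 mod 4, q v2 mod 4, q v3 mod 4, q v4 mod 4) \<in> set symplectic_data"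
      unfolding symplectic_data_def set_product mem_Sigma_iff by simp
    moreover have "lin (v1, v2, v3, v4) \<in> GL4" by (rule lin_in_GL4_mixed[of _ _ 1]) (use v even in simp_all)
    moreover have "\<forall>a. q (lin (v1, v2, v3, v4) a) mod 4 = form (True, q v1 mod 4, q v2 mod 4, q v3 mod 4, q v4 mod 4) a"
      using pullback_form[of v1 v2 True v3 v4] v by (simp del: lin.simps)
    ultimately show ?thesis by blast
  qed
  then obtain p \<phi> where p: "p \<in> set symplectic_data \<union> set diagonal_data" "\<phi> \<in> GL4" "\<And>a. q (\<phi> a) mod 4 = form p a"
    by blast
  then obtain p' \<psi> where p': "p' \<in> set normal_forms" "\<psi> \<in> GL4" "\<And>a. form p (\<psi> a) = form p' a"
    using reduces_imp[OF reduces_symplectic] reduces_imp[OF reduces_diagonal] by (metis Un_iff)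
  have "\<phi> o \<psi> \<in> GL4" "\<forall>a. q ((\<phi> o \<psi>) a) mod 4 = form p' a"
    using GL4_comp[OF p(2) p'(2)] p(3) p'(3) by simp_all
  then show ?thesis using p'(1) by blast
qed

lemma length_filter_points: "length (filter P points) = card {a. P a}"
  using distinct_length_filter[OF distinct_points, of P] by (simp add: set_points)

text \<open>How often a form takes the values 0, 1, 2, 3; a linear bijection preserves these numbers.\<close>

definition value_distribution :: "form_data \<Rightarrow> nat list" where
  "value_distribution p = map (\<lambda>j. length (filter (\<lambda>a. form p a = j) points)) [0, 1, 2, 3]"

lemma distinct_value_distributions: "distinct (map value_distribution normal_forms)"
  by code_simp

lemma normal_form_unique:
  assumes "p \<in> set normal_forms" "p' \<in> set normal_forms" "\<phi> \<in> GL4" "\<And>a. form p (\<phi> a) = form p' a"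
  shows "p = p'"
proof -
  have "bij \<phi>" using assms(3) by (simp add: GL4_def)
  have "card {a. form p' a = j} = card {a. form p a = j}" for j
  proof (rule bij_betw_same_card[of \<phi>])
    have "\<phi> ` {a. form p' a = j} = {a. form p a = j}"
    proof (intro subset_antisym subsetI)
      fix x assume "x \<in> {a. form p a = j}"
      moreover obtain a where "x = \<phi> a" using \<open>bij \<phi>\<close> by (meson bij_pointE)
      ultimately show "x \<in> \<phi> ` {a. form p' a = j}" using assms(4) by auto
    qed (use assms(4) in auto)
    moreover have "inj_on \<phi> {a. form p' a = j}"
      using \<open>bij \<phi>\<close> by (meson bij_is_inj inj_on_subset subset_UNIV)
    ultimately show "bij_betw \<phi> {a. form p' a = j} {a. form p a = j}" by (simp add: bij_betw_def)
  qed
  then have "value_distribution p = value_distribution p'"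
    by (simp add: value_distribution_def length_filter_points)
  then show ?thesis using distinct_value_distributions assms(1,2) by (simp add: distinct_map inj_on_def)
qed

text \<open>The checks below are split into small predicates that are applied partially, so that evaluation by rewriting
does not start on expressions with an unknown point in them.\<close>

definition polar :: "form_data \<Rightarrow> pt \<Rightarrow> pt \<Rightarrow> int" where
  "polar p a b = (form p (a + b) - form p a - form p b) mod 4"

definition not_radical :: "form_data \<Rightarrow> pt \<Rightarrow> bool" where
  "not_radical p a \<longleftrightarrow> \<not> list_all (\<lambda>b. polar p a b = 0) points"

definition nondegenerate_data :: "form_data \<Rightarrow> bool" where
  "nondegenerate_data p \<longleftrightarrow> list_all (not_radical p) nonzero_points"

lemma normal_forms_nondegenerate: "list_all nondegenerate_data normal_forms"
  by code_simp

lemma form_nondegenerate: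
  assumes "p \<in> set normal_forms" "a \<noteq> 0" shows "\<exists>b. (form p (a + b) - form p a - form p b) mod 4 \<noteq> 0"
  using normal_forms_nondegenerate assms set_nonzero_points set_points
  by (fastforce simp: list_all_iff nondegenerate_data_def not_radical_def polar_def)

text \<open>Two distinct nonzero points have inner product 1 with four common points, and a nonzero point has inner product 1
with eight points.\<close>

definition common_count :: "pt \<Rightarrow> pt \<Rightarrow> nat" where
  "common_count x y = length (filter (\<lambda>a. dot a x = 1 \<and> dot a y = 1) points)"

definition common_counts_ok :: "pt \<Rightarrow> bool" where
  "common_counts_ok x \<longleftrightarrow> map (common_count x) nonzero_points = map (\<lambda>y. if x = y then 8 else 4) nonzero_points"

lemma common_counts: "list_all common_counts_ok nonzero_points"
  by code_simp

lemma card_common: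
  assumes "x \<noteq> 0" "y \<noteq> 0" shows "card {a. dot a x = 1 \<and> dot a y = 1} = (if x = y then 8 else 4)"
proof -
  have "\<forall>z\<in>set nonzero_points. common_count x z = (if x = z then 8 else 4)"
    using common_counts assms(1) by (simp add: list_all_iff common_counts_ok_def set_nonzero_points)
  then show ?thesis using assms(2) by (simp add: set_nonzero_points common_count_def length_filter_points)
qed

section \<open>Functions constant on cycles\<close>

definition orbits_under :: "('a \<Rightarrow> 'a) set \<Rightarrow> ('a \<Rightarrow> 'b) set \<Rightarrow> ('a \<Rightarrow> 'b) set set" where
  "orbits_under G F = (\<lambda>f. (\<lambda>\<phi>. f o \<phi>) ` G) ` F"

lemma burnside_precomposition:
  fixes G :: "('a \<Rightarrow> 'a) set" and F :: "('a \<Rightarrow> 'b) set"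
  assumes "finite G" "finite F"
    and id: "id \<in> G" and comp: "\<And>\<phi> \<psi>. \<phi> \<in> G \<Longrightarrow> \<psi> \<in> G \<Longrightarrow> \<phi> o \<psi> \<in> G"
    and inv: "\<And>\<phi>. \<phi> \<in> G \<Longrightarrow> \<exists>\<psi>\<in>G. \<phi> o \<psi> = id"
    and closed: "\<And>f \<phi>. f \<in> F \<Longrightarrow> \<phi> \<in> G \<Longrightarrow> f o \<phi> \<in> F"
  shows "card (orbits_under G F) * card G = (\<Sum>\<phi>\<in>G. card {f \<in> F. f o \<phi> = f})"
proof -
  (* Precomposition is an action from the right, hence the opposite multiplication. *)
  define M :: "('a \<Rightarrow> 'a) monoid" where "M = \<lparr>carrier = G, monoid.mult = (\<lambda>\<phi> \<psi>. \<psi> o \<phi>), one = id\<rparr>"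
  define act where "act \<phi> = (\<lambda>f\<in>F. f o \<phi>)" for \<phi> :: "'a \<Rightarrow> 'a"
  have M: "group M"
    by (rule groupI) (use id comp inv in \<open>auto simp: M_def o_assoc\<close>)
  have bij: "act \<phi> \<in> Bij F" if \<phi>: "\<phi> \<in> G" for \<phi>
  proof -
    obtain \<psi> where \<psi>: "\<psi> \<in> G" "\<phi> o \<psi> = id" using inv \<phi> by blast
    obtain \<chi> where \<chi>: "\<chi> \<in> G" "\<psi> o \<chi> = id" using inv \<psi> by blast
    have "\<chi> = \<phi>" using \<psi>(2) \<chi>(2) by (metis comp_assoc comp_id id_comp)
    then have "\<psi> o \<phi> = id" using \<chi> by simp
    then have "bij_betw (\<lambda>f. f o \<phi>) F F"
      by (intro bij_betw_byWitness[where f' = "\<lambda>f. f o \<psi>"]) (use \<psi> \<phi> closed in \<open>auto simp: comp_assoc\<close>)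
    then show ?thesis by (simp add: act_def Bij_def bij_betw_restrict_eq)
  qed
  have "group_action M F act"
  proof (unfold group_action_def, rule group_hom.intro)
    show "group_hom_axioms M (BijGroup F) act"
    proof (rule group_hom_axioms.intro, rule homI)
      fix \<phi> \<psi> assume *: "\<phi> \<in> carrier M" "\<psi> \<in> carrier M"
      then have "act (\<psi> o \<phi>) = compose F (act \<phi>) (act \<psi>)"
        by (auto simp: act_def compose_def M_def closed o_assoc fun_eq_iff restrict_def)
      then show "act (\<phi> \<otimes>\<^bsub>M\<^esub> \<psi>) = act \<phi> \<otimes>\<^bsub>BijGroup F\<^esub> act \<psi>"
        using * bij by (simp add: M_def BijGroup_def)
    qed (simp add: bij M_def BijGroup_def)
  qed (simp_all add: M group_BijGroup)
  then interpret group_action M F act .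
  have "orbits M F act = orbits_under G F"
    by (auto simp: orbits_def orbit_def orbits_under_def M_def act_def)
  moreover have "invariants F act \<phi> = {f \<in> F. f o \<phi> = f}" for \<phi>
    by (auto simp: invariants_def act_def)
  ultimately show ?thesis
    using burnside assms(1,2) by (simp add: M_def Coset.order_def)
qed

text \<open>The number of functions with values in the natural numbers and sum \<open>k\<close> that are constant on blocks of the given
sizes. It is the coefficient of \<open>x ^ k\<close> in the product of the series \<open>1 / (1 - x ^ c)\<close>, and the recursion expresses
that \<open>1 / (1 - x ^ c) = 1 + x ^ c / (1 - x ^ c)\<close>.\<close>

fun num_constant_on_blocks :: "nat list \<Rightarrow> nat \<Rightarrow> int" where
  "num_constant_on_blocks [] k = of_bool (k = 0)"
| "num_constant_on_blocks (c # cs) k = num_constant_on_blocks cs k + (if c = 0 \<or> k < c then 0 else num_constant_on_blocks (c # cs) (k - c))"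

(* As a rewrite rule this equation does not terminate for unknown arguments. *)
declare num_constant_on_blocks.simps(2) [simp del]

definition block_functions :: "'a list list \<Rightarrow> nat \<Rightarrow> ('a \<Rightarrow> nat) set" where
  "block_functions cs k = {f. (\<forall>a. a \<notin> set (concat cs) \<longrightarrow> f a = 0) \<and>
     (\<forall>c\<in>set cs. \<forall>a\<in>set c. \<forall>b\<in>set c. f a = f b) \<and> sum f (set (concat cs)) = k}"

lemma block_functions_eq:
  assumes "f \<in> block_functions cs k" "c \<in> set cs" "a \<in> set c" "b \<in> set c" shows "f a = f b"
  using assms unfolding block_functions_def by blast

text \<open>A function either vanishes on the first block or stays a natural number after subtraction of 1 on that block, and
these two cases are the two summands of the recursion.\<close>

lemma card_block_functions:
  fixes cs :: "'a list list"
  assumes "distinct (concat cs)"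
  shows "finite (block_functions cs k) \<and> int (card (block_functions cs k)) = num_constant_on_blocks (map length cs) k"
  using assms
proof (induction cs arbitrary: k)
  case Nil
  have "(block_functions [] k :: ('a \<Rightarrow> nat) set) = (if k = 0 then {\<lambda>_. 0} else {})" by (auto simp: block_functions_def)
  then show ?case by simp
next
  case (Cons c cs)
  have disj: "set c \<inter> set (concat cs) = {}" and dc: "distinct c" and dcs: "distinct (concat cs)"
    using Cons.prems by auto
  show ?case
  proof (induction k rule: less_induct)
    case (less k)
    have sum_split: "sum f (set (concat (c # cs))) = sum f (set c) + sum f (set (concat cs))" for f :: "'a \<Rightarrow> nat"
      using disj by (simp add: sum.union_disjoint)
    define Z where "Z = {f \<in> block_functions (c # cs) k. \<forall>a\<in>set c. f a = 0}"
    define P where "P = {f \<in> block_functions (c # cs) k. \<exists>a\<in>set c. f a \<noteq> 0}"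
    have split: "block_functions (c # cs) k = Z \<union> P" "Z \<inter> P = {}" by (auto simp: Z_def P_def)
    have Z: "Z = block_functions cs k"
    proof (intro subset_antisym subsetI)
      fix f assume f: "f \<in> Z"
      then have "sum f (set c) = 0" by (simp add: Z_def)
      then have "sum f (set (concat cs)) = k" using f sum_split[of f] unfolding Z_def block_functions_def mem_Collect_eq by linarith
      moreover have "\<forall>a. a \<notin> set (concat cs) \<longrightarrow> f a = 0"
        using f unfolding Z_def block_functions_def mem_Collect_eq concat.simps set_append by blast
      moreover have "\<forall>c\<in>set cs. \<forall>a\<in>set c. \<forall>b\<in>set c. f a = f b"
        using f unfolding Z_def block_functions_def mem_Collect_eq list.set by blast
      ultimately show "f \<in> block_functions cs k" unfolding block_functions_def by blast
    next
      fix f assume f: "f \<in> block_functions cs k"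
      then have 0: "\<forall>a\<in>set c. f a = 0" using disj unfolding block_functions_def by blast
      then have "sum f (set c) = 0" by simp
      then have "sum f (set (concat (c # cs))) = k" using f sum_split[of f] unfolding block_functions_def mem_Collect_eq by linarith
      moreover have "\<forall>a. a \<notin> set (concat (c # cs)) \<longrightarrow> f a = 0"
        using f unfolding block_functions_def mem_Collect_eq concat.simps set_append by blast
      moreover have "\<forall>d\<in>set (c # cs). \<forall>a\<in>set d. \<forall>b\<in>set d. f a = f b"
      proof (intro ballI)
        fix d a b assume d: "d \<in> set (c # cs)" "a \<in> set d" "b \<in> set d"
        show "f a = f b"
        proof (cases "d = c")
          case False
          then have "d \<in> set cs" using d(1) by simp
          then show ?thesis using f d(2,3) unfolding block_functions_def by blast
        qed (use 0 d in simp)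
      qed
      ultimately show "f \<in> Z" using 0 unfolding Z_def block_functions_def by blast
    qed
    have P: "finite P \<and> int (card P) = (if length c = 0 \<or> k < length c then 0 else num_constant_on_blocks (map length (c # cs)) (k - length c))"
    proof (cases "length c = 0 \<or> k < length c")
      case True
      have "P = {}"
      proof (rule ccontr)
        assume "P \<noteq> {}"
        then obtain f a where f: "f \<in> block_functions (c # cs) k" "a \<in> set c" "f a \<noteq> 0" by (auto simp: P_def)
        then have "f b = f a" if "b \<in> set c" for b using that unfolding block_functions_def list.set by blast
        then have "\<forall>b\<in>set c. 1 \<le> f b" using f(3) by auto
        then have "(\<Sum>b\<in>set c. 1) \<le> sum f (set c)" by (intro sum_mono) auto
        then have "length c \<le> sum f (set c)" using distinct_card[OF dc] by simp
        then have "length c \<le> k" using f(1) unfolding block_functions_def mem_Collect_eq sum_split by linarith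
        then show False using True f(2) by auto
      qed
      then show ?thesis using True by simp
    next
      case False
      let ?B = "block_functions (c # cs) (k - length c)"
      have lc: "length c > 0" "length c \<le> k" using False by auto
      have ind: "(\<Sum>a\<in>set c. of_bool (a \<in> set c)) = length c" "(\<Sum>a\<in>set (concat cs). of_bool (a \<in> set c)) = (0::nat)"
        using distinct_card[OF dc] disj by (auto intro!: sum.neutral)
      have bij: "bij_betw (\<lambda>f a. f a + of_bool (a \<in> set c)) ?B P"
      proof (rule bij_betw_byWitness[where f' = "\<lambda>f a. f a - of_bool (a \<in> set c)"])
        show "\<forall>f\<in>P. (\<lambda>a. f a - of_bool (a \<in> set c) + of_bool (a \<in> set c)) = f"
        proof (intro ballI ext)
          fix f x assume "f \<in> P"
          then obtain a where "a \<in> set c" "f a \<noteq> 0" "x \<in> set c \<Longrightarrow> f x = f a"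
            unfolding P_def block_functions_def list.set by blast
          then have "x \<in> set c \<Longrightarrow> f x \<noteq> 0" by simp
          then show "f x - of_bool (x \<in> set c) + of_bool (x \<in> set c) = f x" by auto
        qed
        show "(\<lambda>f a. f a + of_bool (a \<in> set c)) ` ?B \<subseteq> P"
        proof (rule image_subsetI)
          fix f assume f: "f \<in> ?B"
          let ?g = "\<lambda>a. f a + of_bool (a \<in> set c)"
          have "sum ?g (set (concat (c # cs))) = k"
            using f lc ind unfolding block_functions_def mem_Collect_eq sum_split by (simp only: sum.distrib) linarith
          moreover have "\<forall>a. a \<notin> set (concat (c # cs)) \<longrightarrow> ?g a = 0" using f by (simp add: block_functions_def)
          moreover have "\<forall>d\<in>set (c # cs). \<forall>a\<in>set d. \<forall>b\<in>set d. ?g a = ?g b"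
          proof (intro ballI)
            fix d a b assume d: "d \<in> set (c # cs)" "a \<in> set d" "b \<in> set d"
            have "f a = f b" by (rule block_functions_eq[OF f d])
            moreover have "a \<in> set c \<longleftrightarrow> b \<in> set c" using d disj by auto
            ultimately show "?g a = ?g b" by simp
          qed
          moreover have "\<exists>a\<in>set c. ?g a \<noteq> 0" using lc by (intro bexI[of _ "hd c"]) auto
          ultimately show "?g \<in> P" by (simp only: P_def block_functions_def mem_Collect_eq)
        qed
        show "(\<lambda>f a. f a - of_bool (a \<in> set c)) ` P \<subseteq> ?B"
        proof (rule image_subsetI)
          fix f assume f: "f \<in> P"
          let ?g = "\<lambda>a. f a - of_bool (a \<in> set c)"
          have pos: "f a \<noteq> 0" if "a \<in> set c" for a
          proof -
            obtain b where b: "b \<in> set c" "f b \<noteq> 0" using f unfolding P_def by blast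
            have "f a = f b" by (rule block_functions_eq[of f "c # cs" k c]) (use f b that in \<open>simp_all add: P_def\<close>)
            then show ?thesis using b by simp
          qed
          have "sum f (set c) = sum ?g (set c) + (\<Sum>a\<in>set c. of_bool (a \<in> set c))"
            unfolding sum.distrib[symmetric] by (rule sum.cong) (use pos in simp_all)
          moreover have "sum f (set (concat cs)) = sum ?g (set (concat cs))"
          proof (rule sum.cong)
            fix a assume "a \<in> set (concat cs)"
            then have "a \<notin> set c" using disj by blast
            then show "f a = ?g a" by simp
          qed simp
          ultimately have "sum ?g (set (concat (c # cs))) = k - length c"
            using f ind(1) unfolding P_def block_functions_def mem_Collect_eq sum_split by linarith
          moreover have "\<forall>a. a \<notin> set (concat (c # cs)) \<longrightarrow> ?g a = 0" using f by (simp add: P_def block_functions_def)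
          moreover have "\<forall>d\<in>set (c # cs). \<forall>a\<in>set d. \<forall>b\<in>set d. ?g a = ?g b"
          proof (intro ballI)
            fix d a b assume d: "d \<in> set (c # cs)" "a \<in> set d" "b \<in> set d"
            have "f a = f b" by (rule block_functions_eq[OF _ d, of f k]) (use f in \<open>simp add: P_def\<close>)
            moreover have "a \<in> set c \<longleftrightarrow> b \<in> set c" using d disj by auto
            ultimately show "?g a = ?g b" by simp
          qed
          ultimately show "?g \<in> ?B" by (simp only: block_functions_def mem_Collect_eq)
        qed
      qed auto
      have "finite ?B \<and> int (card ?B) = num_constant_on_blocks (map length (c # cs)) (k - length c)"
        by (rule less.IH) (use lc in linarith)
      then show ?thesis using bij_betw_finite[OF bij] bij_betw_same_card[OF bij] False by simp
    qed
    have "num_constant_on_blocks (map length (c # cs)) k = num_constant_on_blocks (map length cs) k +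
      (if length c = 0 \<or> k < length c then 0 else num_constant_on_blocks (map length (c # cs)) (k - length c))"
      unfolding list.map by (rule num_constant_on_blocks.simps(2))
    moreover have "finite Z" "int (card Z) = num_constant_on_blocks (map length cs) k" using Cons.IH[OF dcs, of k] unfolding Z by simp_all
    ultimately show ?case using P unfolding split(1) by (simp add: card_Un_disjoint[OF _ _ split(2)])
  qed
qed

definition permutes_cycles :: "('a \<Rightarrow> 'a) \<Rightarrow> 'a list list \<Rightarrow> bool" where
  "permutes_cycles \<phi> cs \<longleftrightarrow> distinct (concat cs) \<and> list_all (\<lambda>c. map \<phi> c = rotate1 c) cs"

text \<open>A list of cycles that has been checked with \<open>permutes_cycles\<close> shows the orbits of \<open>\<phi>\<close>, no matter how the list was found.\<close>

lemma invariant_iff_constant_on_cycles: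
  assumes "permutes_cycles \<phi> cs" and "\<And>a. a \<notin> set (concat cs) \<Longrightarrow> \<phi> a = a"
  shows "f o \<phi> = f \<longleftrightarrow> (\<forall>c\<in>set cs. \<forall>a\<in>set c. \<forall>b\<in>set c. f a = f b)"
proof
  have rot: "map \<phi> c = rotate1 c" if "c \<in> set cs" for c using assms(1) that by (simp add: permutes_cycles_def list_all_iff)
  { assume inv: "f o \<phi> = f"
    have const: "f (c ! i) = f (c ! 0)" if c: "c \<in> set cs" "i < length c" for c i
      using c(2)
    proof (induction i)
      case (Suc i)
      have "\<phi> (c ! i) = rotate1 c ! i" using rot[OF c(1)] Suc.prems by (metis Suc_lessD nth_map)
      also have "\<dots> = c ! Suc i" using Suc.prems by (simp add: nth_rotate1)
      finally show ?case using Suc inv by (metis Suc_lessD comp_apply)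
    qed simp
    show "\<forall>c\<in>set cs. \<forall>a\<in>set c. \<forall>b\<in>set c. f a = f b"
      using const by (metis in_set_conv_nth)
  }
  assume const: "\<forall>c\<in>set cs. \<forall>a\<in>set c. \<forall>b\<in>set c. f a = f b"
  show "f o \<phi> = f"
  proof
    fix a
    show "(f o \<phi>) a = f a"
    proof (cases "a \<in> set (concat cs)")
      case True
      then obtain c where c: "c \<in> set cs" "a \<in> set c" by auto
      then have "\<phi> a \<in> set (map \<phi> c)" by simp
      then have "\<phi> a \<in> set c" using rot[OF c(1)] by simp
      then have "f (\<phi> a) = f a" by (rule const[rule_format, OF c(1) _ c(2)])
      then show ?thesis by simp
    qed (simp add: assms(2))
  qed
qed

section \<open>Codes of dimension four\<close>

text \<open>A code is given by the columns \<open>g 0, \<dots>, g (n - 1)\<close> of a generator matrix, and the point \<open>a\<close> stands for the coefficients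
of a linear combination of the rows.\<close>

definition codeword :: "nat \<Rightarrow> (nat \<Rightarrow> pt) \<Rightarrow> pt \<Rightarrow> bit vec" where
  "codeword n g a = vec n (\<lambda>i. dot a (g i))"

definition code :: "nat \<Rightarrow> (nat \<Rightarrow> pt) \<Rightarrow> bit vec set" where
  "code n g = range (codeword n g)"

lemma codeword_carrier [simp]: "codeword n g a \<in> carrier_vec n"
  by (simp add: codeword_def)

lemma codeword_add: "codeword n g (a + b) = codeword n g a + codeword n g b"
  by (rule eq_vecI) (simp_all add: codeword_def dot_add_left)

lemma codeword_0: "codeword n g 0 = 0\<^sub>v n"
  by (rule eq_vecI) (simp_all add: codeword_def)

lemma codeword_eq_iff: "codeword n g a = codeword n g b \<longleftrightarrow> codeword n g (a + b) = 0\<^sub>v n"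
proof
  assume *: "codeword n g (a + b) = 0\<^sub>v n"
  show "codeword n g a = codeword n g b"
  proof (rule eq_vecI)
    fix i assume "i < dim_vec (codeword n g b)"
    then have i: "i < n" by (simp add: codeword_def)
    then have "dot (a + b) (g i) = 0"
      using arg_cong[OF *, of "\<lambda>v. v $ i"] by (simp add: codeword_def)
    then have "dot a (g i) + dot b (g i) = 0" by (simp only: dot_add_left)
    then show "codeword n g a $ i = codeword n g b $ i"
      using i by (cases "dot a (g i)"; cases "dot b (g i)") (simp_all add: codeword_def)
  qed (simp add: codeword_def)
next
  assume "codeword n g a = codeword n g b"
  then have "codeword n g (a + b) = codeword n g b + codeword n g b" by (simp add: codeword_add)
  also have "\<dots> = 0\<^sub>v n" by (rule eq_vecI) (simp_all add: codeword_def)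
  finally show "codeword n g (a + b) = 0\<^sub>v n" .
qed

lemma inj_codeword_iff: "inj (codeword n g) \<longleftrightarrow> (\<forall>a. codeword n g a = 0\<^sub>v n \<longrightarrow> a = 0)"
  unfolding inj_def codeword_eq_iff
  by (metis add_0_right pt_add_eq_0_iff)

lemma sum_four: "distinct [a, b, c, d] \<Longrightarrow> sum f {a, b, c, d} = f a + f b + f c + f d"
  for f :: "'a \<Rightarrow> 'b::comm_monoid_add"
  by (simp add: add.assoc)

lemma span_four:
  fixes b1 :: "bit vec"
  assumes "distinct [b1, b2, b3, b4]" "{b1, b2, b3, b4} \<subseteq> carrier_vec n" "\<And>i. i < n \<Longrightarrow> g i = (b1 $ i, b2 $ i, b3 $ i, b4 $ i)"
  shows "module.lincomb (module_vec TYPE(bit) n) c {b1, b2, b3, b4} = codeword n g (c b1, c b2, c b3, c b4)"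
proof -
  interpret V: vec_space "TYPE(bit)" n .
  show ?thesis
  proof (rule eq_vecI)
    fix i assume "i < dim_vec (codeword n g (c b1, c b2, c b3, c b4))"
    then have i: "i < n" by (simp add: codeword_def)
    have "V.lincomb c {b1, b2, b3, b4} $ i = (\<Sum>x\<in>{b1, b2, b3, b4}. c x * x $ i)"
      by (rule V.lincomb_index[OF i assms(2)])
    also have "\<dots> = codeword n g (c b1, c b2, c b3, c b4) $ i"
      unfolding sum_four[OF assms(1)] using i by (simp only: codeword_def index_vec assms(3) dot_unfold)
    finally show "V.lincomb c {b1, b2, b3, b4} $ i = codeword n g (c b1, c b2, c b3, c b4) $ i" .
  qed (use V.lincomb_dim[OF _ assms(2)] in \<open>simp add: codeword_def\<close>)
qed

lemma lin_indpt_iff_inj_codeword: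
  fixes b1 :: "bit vec"
  assumes "distinct [b1, b2, b3, b4]" "{b1, b2, b3, b4} \<subseteq> carrier_vec n" "\<And>i. i < n \<Longrightarrow> g i = (b1 $ i, b2 $ i, b3 $ i, b4 $ i)"
  shows "\<not> module.lin_dep class_ring (module_vec TYPE(bit) n) {b1, b2, b3, b4} \<longleftrightarrow> inj (codeword n g)"
    "LinearCombinations.module.span class_ring (module_vec TYPE(bit) n) {b1, b2, b3, b4} = code n g"
proof -
  interpret V: vec_space "TYPE(bit)" n .
  have coeff: "\<exists>c. a = (c b1, c b2, c b3, c b4)" for a :: pt
  proof -
    obtain a1 a2 a3 a4 where "a = (a1, a2, a3, a4)" by (cases a)
    then show ?thesis using assms(1)
      by (intro exI[of _ "\<lambda>x. if x = b1 then a1 else if x = b2 then a2 else if x = b3 then a3 else a4"]) auto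
  qed
  have "V.span {b1, b2, b3, b4} = {V.lincomb c {b1, b2, b3, b4} | c. c \<in> {b1, b2, b3, b4} \<rightarrow> UNIV}"
    using V.finite_span[of "{b1, b2, b3, b4}"] assms(2) by simp
  also have "\<dots> = code n g"
  proof (intro subset_antisym subsetI)
    fix x assume "x \<in> code n g"
    then obtain a where a: "x = codeword n g a" by (auto simp: code_def)
    obtain c where "a = (c b1, c b2, c b3, c b4)" using coeff by blast
    then have "x = V.lincomb c {b1, b2, b3, b4}" using a span_four[OF assms, of c] by simp
    then show "x \<in> {V.lincomb c {b1, b2, b3, b4} | c. c \<in> {b1, b2, b3, b4} \<rightarrow> UNIV}" by blast
  qed (auto simp: span_four[OF assms] code_def)
  finally show "V.span {b1, b2, b3, b4} = code n g" .
  have "V.lin_dep {b1, b2, b3, b4} \<longleftrightarrow> (\<exists>c v. codeword n g (c b1, c b2, c b3, c b4) = 0\<^sub>v n \<and> v \<in> {b1, b2, b3, b4} \<and> c v \<noteq> 0)"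
  proof
    assume "V.lin_dep {b1, b2, b3, b4}"
    then obtain A c v where A: "finite A" "A \<subseteq> {b1, b2, b3, b4}" "V.lincomb c A = 0\<^sub>v n" "v \<in> A" "c v \<noteq> 0"
      unfolding V.lin_dep_def by blast
    define c' where "c' x = (if x \<in> A then c x else 0)" for x
    have AV: "A \<subseteq> carrier_vec n" using A(2) assms(2) by blast
    have "V.lincomb c' {b1, b2, b3, b4} = V.lincomb c A"
    proof (rule eq_vecI)
      fix i assume "i < dim_vec (V.lincomb c A)"
      then have i: "i < n" using A(3) by simp
      have "V.lincomb c' {b1, b2, b3, b4} $ i = (\<Sum>x\<in>{b1, b2, b3, b4}. c' x * x $ i)"
        by (rule V.lincomb_index[OF i assms(2)])
      also have "\<dots> = (\<Sum>x\<in>A. c x * x $ i)"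
        by (rule sum.mono_neutral_cong_right) (use A(2) in \<open>auto simp: c'_def\<close>)
      also have "\<dots> = V.lincomb c A $ i" by (rule V.lincomb_index[OF i AV, symmetric])
      finally show "V.lincomb c' {b1, b2, b3, b4} $ i = V.lincomb c A $ i" .
    qed (use V.lincomb_dim[OF _ assms(2)] V.lincomb_dim[OF A(1) AV] in simp)
    then show "\<exists>c v. codeword n g (c b1, c b2, c b3, c b4) = 0\<^sub>v n \<and> v \<in> {b1, b2, b3, b4} \<and> c v \<noteq> 0"
      using A span_four[OF assms, of c'] by (intro exI[of _ c'] exI[of _ v]) (auto simp: c'_def)
  next
    assume "\<exists>c v. codeword n g (c b1, c b2, c b3, c b4) = 0\<^sub>v n \<and> v \<in> {b1, b2, b3, b4} \<and> c v \<noteq> 0"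
    then show "V.lin_dep {b1, b2, b3, b4}"
      unfolding V.lin_dep_def using span_four[OF assms] by (metis finite.emptyI finite.insertI order_refl)
  qed
  also have "\<dots> \<longleftrightarrow> (\<exists>a. codeword n g a = 0\<^sub>v n \<and> a \<noteq> 0)"
  proof
    assume "\<exists>c v. codeword n g (c b1, c b2, c b3, c b4) = 0\<^sub>v n \<and> v \<in> {b1, b2, b3, b4} \<and> c v \<noteq> 0"
    then obtain c v where *: "codeword n g (c b1, c b2, c b3, c b4) = 0\<^sub>v n" "v \<in> {b1, b2, b3, b4}" "c v \<noteq> 0" by blast
    then have "(c b1, c b2, c b3, c b4) \<noteq> 0" by (auto simp: zero_prod_def)
    then show "\<exists>a. codeword n g a = 0\<^sub>v n \<and> a \<noteq> 0" using * by blast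
  next
    assume "\<exists>a. codeword n g a = 0\<^sub>v n \<and> a \<noteq> 0"
    then obtain a where a: "codeword n g a = 0\<^sub>v n" "a \<noteq> 0" by blast
    obtain c where c: "a = (c b1, c b2, c b3, c b4)" using coeff by blast
    then have "\<exists>v\<in>{b1, b2, b3, b4}. c v \<noteq> 0" using a(2) by (auto simp: zero_prod_def)
    then show "\<exists>c v. codeword n g (c b1, c b2, c b3, c b4) = 0\<^sub>v n \<and> v \<in> {b1, b2, b3, b4} \<and> c v \<noteq> 0"
      using a(1) unfolding c by blast
  qed
  finally show "\<not> V.lin_dep {b1, b2, b3, b4} \<longleftrightarrow> inj (codeword n g)"
    unfolding inj_codeword_iff by blast
qed

lemma finite_carrier_vec_bit: "finite (carrier_vec n :: bit vec set)"
proof -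
  have "x \<in> (\<lambda>S. vec n (\<lambda>i. of_bool (i \<in> S))) ` Pow {..<n}" if x: "x \<in> carrier_vec n" for x :: "bit vec"
  proof (rule image_eqI[of _ _ "{i. i < n \<and> x $ i = 1}"])
    show "x = vec n (\<lambda>i. of_bool (i \<in> {i. i < n \<and> x $ i = 1}))"
    proof (rule eq_vecI)
      fix i assume "i < dim_vec (vec n (\<lambda>i. of_bool (i \<in> {i. i < n \<and> x $ i = 1})) :: bit vec)"
      then show "x $ i = vec n (\<lambda>i. of_bool (i \<in> {i. i < n \<and> x $ i = 1})) $ i"
        by (cases "x $ i") simp_all
    qed (simp add: carrier_vecD[OF x])
  qed blast
  then have "(carrier_vec n :: bit vec set) \<subseteq> (\<lambda>S. vec n (\<lambda>i. of_bool (i \<in> S))) ` Pow {..<n}" by blast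
  then show ?thesis by (rule finite_subset) simp
qed

text \<open>A basis of the code supplies the rows of a generator matrix. The converse holds because the rows are then independent.\<close>

lemma binary_code_4_iff:
  "binary_code n 4 C \<longleftrightarrow> (\<exists>g. C = code n g \<and> inj (codeword n g))"
proof
  interpret V: vec_space "TYPE(bit)" n .
  assume C: "binary_code n 4 C"
  then have sub: "VectorSpace.subspace class_ring C V.V" by (simp add: binary_code_def)
  then have subm: "submodule class_ring C V.V" by (simp add: VectorSpace.subspace_def)
  have CV: "C \<subseteq> carrier_vec n" using subm by (auto simp: submodule_def)
  interpret W: vectorspace class_ring "V.vs C" by (rule V.subspace_is_vs[OF sub])
  have span: "W.span S = V.span S" if "S \<subseteq> C" for S using V.span_li_not_depend(1)[OF that subm] .
  have dep: "W.lin_dep S = V.lin_dep S" if "S \<subseteq> C" for S using V.span_li_not_depend(2)[OF that subm] .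
  have "finite C" using CV finite_carrier_vec_bit finite_subset by blast
  have "W.gen_set C" using W.in_own_span[of C] W.span_is_subset2[of C] by auto
  then have "W.fin_dim" unfolding W.fin_dim_def using \<open>finite C\<close> by auto
  then obtain B where B: "finite B" "W.basis B" using W.finite_basis_exists by blast
  have "card B = 4" using W.dim_basis[OF B] C by (simp add: binary_code_def)
  then obtain xs where xs: "distinct xs" "set xs = B" "length xs = 4"
    using finite_distinct_list[OF B(1)] distinct_card by metis
  then obtain b1 b2 b3 b4 where "xs = [b1, b2, b3, b4]"
    by (auto simp: numeral_eq_Suc length_Suc_conv)
  then have b: "distinct [b1, b2, b3, b4]" "B = {b1, b2, b3, b4}" using xs by auto
  have BC: "B \<subseteq> C" using B(2) unfolding W.basis_def by simp
  define g where "g i = (b1 $ i, b2 $ i, b3 $ i, b4 $ i)" for i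
  have BV: "{b1, b2, b3, b4} \<subseteq> carrier_vec n" using BC CV b(2) by blast
  have "V.span B = C" "\<not> V.lin_dep B" using B(2) span[OF BC] dep[OF BC] unfolding W.basis_def by simp_all
  then show "\<exists>g. C = code n g \<and> inj (codeword n g)"
    using lin_indpt_iff_inj_codeword[OF b(1) BV, of g] unfolding b(2) g_def by blast
next
  interpret V: vec_space "TYPE(bit)" n .
  assume "\<exists>g. C = code n g \<and> inj (codeword n g)"
  then obtain g where C: "C = code n g" and inj: "inj (codeword n g)" by blast
  define b1 b2 b3 b4 where b: "b1 = codeword n g (1,0,0,0)" "b2 = codeword n g (0,1,0,0)"
    "b3 = codeword n g (0,0,1,0)" "b4 = codeword n g (0,0,0,1)"
  have dist: "distinct [b1, b2, b3, b4]" unfolding b using inj by (simp add: inj_eq)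
  have BV: "{b1, b2, b3, b4} \<subseteq> carrier_vec n" unfolding b by simp
  have gi: "g i = (b1 $ i, b2 $ i, b3 $ i, b4 $ i)" if "i < n" for i
    using that unfolding b by (cases "g i") (simp add: codeword_def dot_unfold)
  have span: "V.span {b1, b2, b3, b4} = C" and indpt: "\<not> V.lin_dep {b1, b2, b3, b4}"
    using lin_indpt_iff_inj_codeword[OF dist BV gi] C inj by simp_all
  have sub: "VectorSpace.subspace class_ring C V.V"
    unfolding span[symmetric] by (rule V.span_is_subspace) (use BV in simp)
  then have subm: "submodule class_ring C V.V" by (simp add: VectorSpace.subspace_def)
  interpret W: vectorspace class_ring "V.vs C" by (rule V.subspace_is_vs[OF sub])
  have BC: "{b1, b2, b3, b4} \<subseteq> C" unfolding C code_def b by auto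
  have "W.basis {b1, b2, b3, b4}"
    unfolding W.basis_def V.span_li_not_depend[OF BC subm] using span indpt BC by simp
  then have "W.dim = card {b1, b2, b3, b4}" by (intro W.dim_basis) simp_all
  also have "\<dots> = 4" using dist by simp
  finally show "binary_code n 4 C" using sub by (simp add: binary_code_def)
qed

section \<open>Weights and inner products\<close>

definition wt :: "nat \<Rightarrow> (nat \<Rightarrow> pt) \<Rightarrow> pt \<Rightarrow> nat" where
  "wt n g a = card {i. i < n \<and> dot a (g i) = 1}"

definition gram :: "nat \<Rightarrow> (nat \<Rightarrow> pt) \<Rightarrow> pt \<Rightarrow> pt \<Rightarrow> bit" where
  "gram n g a b = (\<Sum>i<n. dot a (g i) * dot b (g i))"

lemma hamming_weight_codeword: "hamming_weight (codeword n g a) = wt n g a"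
proof -
  have "{i. i < dim_vec (codeword n g a) \<and> codeword n g a $ i \<noteq> 0} = {i. i < n \<and> dot a (g i) = 1}"
    by (auto simp: codeword_def)
  then show ?thesis by (simp add: hamming_weight_def wt_def)
qed

lemma wt_0 [simp]: "wt n g 0 = 0"
  by (simp add: wt_def)

lemma scalar_prod_codeword: "codeword n g a \<bullet> codeword n g b = gram n g a b"
  by (simp add: scalar_prod_def codeword_def gram_def lessThan_atLeast0)

lemma of_nat_bit: "(of_nat m = (1::bit)) \<longleftrightarrow> odd m"
  by (induction m) auto

lemma gram_eq_1_iff: "gram n g a b = 1 \<longleftrightarrow> odd (card {i. i < n \<and> dot a (g i) = 1 \<and> dot b (g i) = 1})"
proof -
  have "gram n g a b = (\<Sum>i<n. of_bool (dot a (g i) = 1 \<and> dot b (g i) = 1))"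
    unfolding gram_def
  proof (rule sum.cong)
    fix i show "dot a (g i) * dot b (g i) = of_bool (dot a (g i) = 1 \<and> dot b (g i) = 1)"
      by (cases "dot a (g i)"; cases "dot b (g i)") simp_all
  qed simp
  also have "\<dots> = of_nat (\<Sum>i<n. of_bool (dot a (g i) = 1 \<and> dot b (g i) = 1))" by (simp only: of_nat_sum of_nat_of_bool)
  also have "(\<Sum>i<n. of_bool (dot a (g i) = 1 \<and> dot b (g i) = 1)) = card {i. i < n \<and> dot a (g i) = 1 \<and> dot b (g i) = 1}"
    by (subst sum_of_bool_eq) (auto intro!: arg_cong[where f = card])
  finally show ?thesis by (simp only: of_nat_bit)
qed

lemma wt_add: "wt n g (a + b) + 2 * card {i. i < n \<and> dot a (g i) = 1 \<and> dot b (g i) = 1} = wt n g a + wt n g b"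
proof -
  let ?A = "{i. i < n \<and> dot a (g i) = 1}" and ?B = "{i. i < n \<and> dot b (g i) = 1}"
  have 1: "(x + y = (1::bit)) \<longleftrightarrow> (x = 1 \<and> y \<noteq> 1) \<or> (y = 1 \<and> x \<noteq> 1)" for x y
    by (cases x; cases y) simp_all
  have "{i. i < n \<and> dot (a + b) (g i) = 1} = (?A - ?B) \<union> (?B - ?A)"
    unfolding dot_add_left 1 by blast
  then have "wt n g (a + b) = card (?A - ?B) + card (?B - ?A)"
    by (simp only: wt_def) (rule card_Un_disjoint, auto)
  moreover have "card ?A = card (?A - ?B) + card (?A \<inter> ?B)" "card ?B = card (?B - ?A) + card (?A \<inter> ?B)"
    by (subst card_Un_disjoint[symmetric]; (auto intro!: arg_cong[where f = card])[1])+
  moreover have "card {i. i < n \<and> dot a (g i) = 1 \<and> dot b (g i) = 1} = card (?A \<inter> ?B)"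
    by (rule arg_cong[where f = card]) blast
  ultimately show ?thesis unfolding wt_def by linarith
qed

text \<open>The weight is quadratic modulo 4, because the number of common coordinates only matters modulo 2.\<close>

lemma wt_add_mod_4: "int (wt n g (a + b)) mod 4 = (int (wt n g a) + int (wt n g b) + 2 * of_bool (gram n g a b = 1)) mod 4"
proof -
  define c where "c = card {i. i < n \<and> dot a (g i) = 1 \<and> dot b (g i) = 1}"
  have eq: "int (wt n g (a + b)) = int (wt n g a) + int (wt n g b) + 2 * of_bool (odd c) - 2 * (int c + of_bool (odd c))"
    using arg_cong[OF wt_add[of n g a b, folded c_def], of int] by (simp add: algebra_simps)
  have "4 dvd 2 * (int c + of_bool (odd c))" by (cases "odd c") (auto elim!: oddE evenE)
  then obtain k where "2 * (int c + of_bool (odd c)) = 4 * k" by (elim dvdE)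
  then have "int (wt n g (a + b)) - (int (wt n g a) + int (wt n g b) + 2 * of_bool (odd c)) = 4 * (- k)" using eq by linarith
  then show ?thesis unfolding gram_eq_1_iff c_def[symmetric] mod_eq_dvd_iff by (simp only: dvd_triv_left)
qed

lemma gram_add_left: "gram n g (a + b) c = gram n g a c + gram n g b c"
  by (simp only: gram_def dot_add_left distrib_right sum.distrib)

lemma gram_commute: "gram n g a b = gram n g b a"
  by (simp only: gram_def mult.commute)

definition nondegenerate_gram :: "nat \<Rightarrow> (nat \<Rightarrow> pt) \<Rightarrow> bool" where
  "nondegenerate_gram n g \<longleftrightarrow> (\<forall>a. a \<noteq> 0 \<longrightarrow> (\<exists>b. gram n g a b = 1))"

lemma nondegenerate_form_wt:
  assumes "nondegenerate_gram n g" shows "nondegenerate_form (\<lambda>a. int (wt n g a)) (gram n g)"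
proof
  show "a \<noteq> 0 \<Longrightarrow> \<exists>b. gram n g a b = 1" for a using assms unfolding nondegenerate_gram_def by blast
qed (rule wt_add_mod_4 gram_add_left gram_commute)+

lemma codeword_eq_0_imp: "codeword n g a = 0\<^sub>v n \<Longrightarrow> gram n g a b = 0"
  unfolding scalar_prod_codeword[symmetric] by simp

lemma inj_codeword_if_nondegenerate:
  assumes "nondegenerate_gram n g" shows "inj (codeword n g)"
  unfolding inj_codeword_iff using assms codeword_eq_0_imp unfolding nondegenerate_gram_def by (metis zero_neq_one)

text \<open>The radical of the inner product on a code is its intersection with the dual code.\<close>

lemma LCD_code_iff:
  assumes "inj (codeword n g)" shows "LCD n (code n g) \<longleftrightarrow> nondegenerate_gram n g"
proof -
  have "codeword n g a \<in> dual_code n (code n g) \<longleftrightarrow> (\<forall>b. gram n g a b = 0)" for a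
    unfolding dual_code_def vec_module.orthogonal_complement_def code_def by (simp add: scalar_prod_codeword)
  then have "code n g \<inter> dual_code n (code n g) = codeword n g ` {a. \<forall>b. gram n g a b = 0}"
    unfolding code_def by blast
  moreover have "{0\<^sub>v n} = codeword n g ` {0}" by (simp add: codeword_0)
  ultimately have "LCD n (code n g) \<longleftrightarrow> {a. \<forall>b. gram n g a b = 0} = {0}"
    unfolding LCD_def using assms by (simp only: inj_image_eq_iff)
  also have "\<dots> \<longleftrightarrow> nondegenerate_gram n g"
  proof -
    have "gram n g 0 b = 0" for b by (simp add: gram_def)
    moreover have "(\<forall>b. gram n g a b = 0) \<longleftrightarrow> \<not> (\<exists>b. gram n g a b = 1)" for a by (metis bit_not_one_iff)
    ultimately show ?thesis unfolding nondegenerate_gram_def set_eq_iff mem_Collect_eq singleton_iff by metis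
  qed
  finally show ?thesis .
qed

lemma min_weight_code:
  assumes "inj (codeword n g)" shows "min_weight n (code n g) = Min (wt n g ` (- {0}))"
proof -
  have "{hamming_weight x | x. x \<in> code n g \<and> x \<noteq> 0\<^sub>v n} = wt n g ` (- {0})"
    using assms codeword_0[of n g] unfolding code_def inj_codeword_iff hamming_weight_codeword[symmetric] by blast
  then show ?thesis by (simp add: min_weight_def)
qed

section \<open>Weights and multiplicities of columns\<close>

text \<open>This turns multiplicities of columns into weights (\<open>wt_eq_transform\<close>). Up to scaling and a constant it is its own inverse
(\<open>transform_transform\<close>), because the matrix of inner products on the nonzero points is the incidence
matrix of a symmetric design.\<close>

definition transform :: "(pt \<Rightarrow> int) \<Rightarrow> pt \<Rightarrow> int" where
  "transform m a = (\<Sum>x\<in>UNIV. of_bool (dot a x = 1) * m x)"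

lemma transform_0 [simp]: "transform m 0 = 0"
  by (simp add: transform_def)

lemma transform_transform:
  assumes "x \<noteq> 0" shows "transform (transform m) x = 4 * (\<Sum>y\<in>-{0}. m y) + 4 * m x"
proof -
  have "transform (transform m) x = (\<Sum>a\<in>UNIV. \<Sum>y\<in>UNIV. of_bool (dot x a = 1 \<and> dot a y = 1) * m y)"
    unfolding transform_def sum_distrib_left by (intro sum.cong refl) (simp add: of_bool_conj)
  also have "\<dots> = (\<Sum>y\<in>UNIV. \<Sum>a\<in>UNIV. of_bool (dot x a = 1 \<and> dot a y = 1) * m y)" by (rule sum.swap)
  also have "\<dots> = (\<Sum>y\<in>UNIV. int (card {a. dot a x = 1 \<and> dot a y = 1}) * m y)"
    unfolding sum_distrib_right[symmetric] by (simp add: sum_of_bool_eq dot_commute[of x])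
  also have "\<dots> = (\<Sum>y\<in>-{0}. int (card {a. dot a x = 1 \<and> dot a y = 1}) * m y)"
    by (rule sum.mono_neutral_right) auto
  also have "\<dots> = (\<Sum>y\<in>-{0}. 4 * m y + (if y = x then 4 * m y else 0))"
    by (rule sum.cong) (use assms in \<open>auto simp: card_common\<close>)
  also have "\<dots> = 4 * (\<Sum>y\<in>-{0}. m y) + 4 * m x"
    using assms by (simp add: sum.distrib sum.delta sum_distrib_left)
  finally show ?thesis .
qed

lemma sum_transform: "(\<Sum>a\<in>UNIV. transform m a) = 8 * (\<Sum>y\<in>-{0}. m y)"
proof -
  have "(\<Sum>a\<in>UNIV. transform m a) = (\<Sum>y\<in>UNIV. \<Sum>a\<in>UNIV. of_bool (dot a y = 1) * m y)"
    unfolding transform_def by (rule sum.swap)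
  also have "\<dots> = (\<Sum>y\<in>UNIV. int (card {a. dot a y = 1}) * m y)"
    unfolding sum_distrib_right[symmetric] by (simp add: sum_of_bool_eq)
  also have "\<dots> = (\<Sum>y\<in>-{0}. int (card {a. dot a y = 1}) * m y)"
    by (rule sum.mono_neutral_right) auto
  also have "\<dots> = (\<Sum>y\<in>-{0}. 8 * m y)"
  proof (rule sum.cong)
    fix y :: pt assume "y \<in> - {0}"
    then have "card {a. dot a y = 1} = 8" using card_common[of y y] by simp
    then show "int (card {a. dot a y = 1}) * m y = 8 * m y" by simp
  qed simp
  finally show ?thesis by (simp add: sum_distrib_left)
qed

definition multiplicity_of :: "nat \<Rightarrow> (nat \<Rightarrow> pt) \<Rightarrow> pt \<Rightarrow> nat" where
  "multiplicity_of n g x = card {i. i < n \<and> g i = x}"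

lemma wt_eq_transform: "int (wt n g a) = transform (\<lambda>x. int (multiplicity_of n g x)) a"
proof -
  have "wt n g a = card (\<Union>x\<in>{x. dot a x = 1}. {i. i < n \<and> g i = x})"
    unfolding wt_def by (rule arg_cong[where f = card]) blast
  also have "\<dots> = (\<Sum>x\<in>{x. dot a x = 1}. multiplicity_of n g x)"
    unfolding multiplicity_of_def by (rule card_UN_disjoint) auto
  also have "int \<dots> = transform (\<lambda>x. int (multiplicity_of n g x)) a"
    unfolding transform_def of_nat_sum by (rule sum.mono_neutral_cong_left) auto
  finally show ?thesis .
qed

lemma sum_multiplicity: "(\<Sum>x\<in>-{0}. multiplicity_of n g x) = card {i. i < n \<and> g i \<noteq> 0}"
proof -
  have "card {i. i < n \<and> g i \<noteq> 0} = card (\<Union>x\<in>-{0}. {i. i < n \<and> g i = x})"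
    by (rule arg_cong[where f = card]) blast
  also have "\<dots> = (\<Sum>x\<in>-{0}. multiplicity_of n g x)"
    unfolding multiplicity_of_def by (rule card_UN_disjoint) auto
  finally show ?thesis ..
qed

lemma sum_wt: "(\<Sum>a\<in>UNIV. int (wt n g a)) = 8 * int (card {i. i < n \<and> g i \<noteq> 0})"
  unfolding wt_eq_transform sum_transform sum_multiplicity[symmetric] of_nat_sum ..

lemma sum_nonzero: "f 0 = 0 \<Longrightarrow> (\<Sum>a\<in>UNIV. f a) = (\<Sum>a\<in>-{0::pt}. f a :: 'a::comm_monoid_add)"
  by (rule sum.mono_neutral_right) auto

lemma wt_determines_multiplicity:
  assumes "\<And>i. i < n \<Longrightarrow> g i \<noteq> 0" "\<And>i. i < n \<Longrightarrow> h i \<noteq> 0" "wt n g = wt n h"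
  shows "multiplicity_of n g x = multiplicity_of n h x"
proof (cases "x = 0")
  case True
  then have "{i. i < n \<and> g i = x} = {}" "{i. i < n \<and> h i = x} = {}" using assms(1,2) by auto
  then show ?thesis by (simp only: multiplicity_of_def)
next
  case False
  have tot: "(\<Sum>y\<in>-{0}. int (multiplicity_of n k y)) = int n" if "\<And>i. i < n \<Longrightarrow> k i \<noteq> 0" for k
  proof -
    have "{i. i < n \<and> k i \<noteq> 0} = {..<n}" using that by auto
    then show ?thesis using sum_multiplicity[of n k] by (simp flip: of_nat_sum)
  qed
  have "transform (\<lambda>x. int (multiplicity_of n g x)) = transform (\<lambda>x. int (multiplicity_of n h x))"
    using assms(3) by (simp add: fun_eq_iff flip: wt_eq_transform)
  then have "transform (transform (\<lambda>x. int (multiplicity_of n g x))) x = transform (transform (\<lambda>x. int (multiplicity_of n h x))) x" by simp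
  then show ?thesis unfolding transform_transform[OF False] using tot[of g] tot[of h] assms(1,2) by simp
qed

lemma permutation_if_same_multiplicity:
  assumes "\<And>x. multiplicity_of n g x = multiplicity_of n h x"
  shows "\<exists>\<pi>. \<pi> permutes {..<n} \<and> (\<forall>i<n. g i = h (\<pi> i))"
proof -
  have "count (mset (map k [0..<n])) x = multiplicity_of n k x" for k :: "nat \<Rightarrow> pt" and x
    unfolding multiplicity_of_def count_mset count_list_eq_length_filter length_filter_conv_card by (rule arg_cong[where f = card]) auto
  then have "mset (map g [0..<n]) = mset (map h [0..<n])" using assms by (simp add: multiset_eq_iff)
  then obtain \<pi> where \<pi>: "\<pi> permutes {..<n}" "permute_list \<pi> (map h [0..<n]) = map g [0..<n]"
    using mset_eq_permutation[of "map g [0..<n]" "map h [0..<n]"] by auto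
  have "g i = h (\<pi> i)" if "i < n" for i
  proof -
    have "g i = permute_list \<pi> (map h [0..<n]) ! i" using that \<pi>(2) by simp
    also have "\<dots> = h (\<pi> i)" using that permutes_in_image[OF \<pi>(1), of i] by (simp add: permute_list_nth \<pi>(1))
    finally show ?thesis .
  qed
  then show ?thesis using \<pi>(1) by blast
qed

lemma exists_columns:
  assumes "(\<Sum>x\<in>UNIV. m x) = n"
  shows "\<exists>g. \<forall>x. multiplicity_of n g x = m x"
proof -
  have "count (\<Sum>x\<in>UNIV. replicate_mset (m x) x) y = m y" for y :: pt
    by (simp add: count_sum)
  moreover have "size (\<Sum>x\<in>(UNIV :: pt set). replicate_mset (m x) x) = n" using assms by (simp add: size_multiset_sum)
  ultimately obtain M :: "pt multiset" where M: "\<And>y. count M y = m y" "size M = n"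
    by (rule that[of "\<Sum>x\<in>UNIV. replicate_mset (m x) x"])
  obtain xs where xs: "mset xs = M" using ex_mset by blast
  have "multiplicity_of n (\<lambda>i. xs ! i) x = m x" for x
  proof -
    have "length xs = n" using M(2) xs size_mset by metis
    then have "multiplicity_of n (\<lambda>i. xs ! i) x = count (mset xs) x"
      unfolding multiplicity_of_def count_mset count_list_eq_length_filter length_filter_conv_card by (intro arg_cong[where f = card]) auto
    then show ?thesis using M(1) xs by simp
  qed
  then show ?thesis by blast
qed

section \<open>Equivalence of codes\<close>

lemma codeword_eq_0_iff: "codeword n g a = 0\<^sub>v n \<longleftrightarrow> wt n g a = 0"
proof
  assume "wt n g a = 0"
  then have "{i. i < n \<and> dot a (g i) = 1} = {}" by (simp add: wt_def)
  then show "codeword n g a = 0\<^sub>v n" by (intro eq_vecI) (auto simp: codeword_def)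
next
  assume *: "codeword n g a = 0\<^sub>v n"
  have "dot a (g i) = 0" if "i < n" for i
    using arg_cong[OF *, of "\<lambda>v. v $ i"] that by (simp add: codeword_def)
  then have "{i. i < n \<and> dot a (g i) = 1} = {}" by fastforce
  then show "wt n g a = 0" by (simp only: wt_def card.empty)
qed

lemma permute_codeword:
  assumes "\<pi> permutes {..<n}"
  shows "permute_coords n \<pi> (codeword n g a) = codeword n (\<lambda>i. g (\<pi> i)) a"
  by (rule eq_vecI) (use permutes_in_image[OF assms] in \<open>simp_all add: permute_coords_def codeword_def\<close>)

lemma wt_permute:
  assumes "\<pi> permutes {..<n}" shows "wt n (\<lambda>i. g (\<pi> i)) a = wt n g a"
proof -
  have "\<pi> ` {i. i < n \<and> dot a (g (\<pi> i)) = 1} = {i. i < n \<and> dot a (g i) = 1}"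
  proof (intro subset_antisym subsetI)
    fix j assume j: "j \<in> {i. i < n \<and> dot a (g i) = 1}"
    then have "j \<in> \<pi> ` {..<n}" using permutes_image[OF assms] by simp
    then obtain i where "i < n" "j = \<pi> i" by blast
    then show "j \<in> \<pi> ` {i. i < n \<and> dot a (g (\<pi> i)) = 1}" using j by blast
  qed (use permutes_in_image[OF assms] in auto)
  then have "card {i. i < n \<and> dot a (g i) = 1} = card {i. i < n \<and> dot a (g (\<pi> i)) = 1}"
    by (metis (no_types, lifting) card_image inj_on_subset permutes_inj[OF assms] subset_UNIV)
  then show ?thesis by (simp add: wt_def)
qed

text \<open>A permutation of coordinates is linear on words and preserves their weights, so it induces a linear bijection of
the coefficients.\<close>

lemma code_equiv_imp_wt:
  assumes "(code n g, code n h) \<in> code_equiv n 4" and inj: "inj (codeword n g)" "inj (codeword n h)"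
  shows "\<exists>\<phi>\<in>GL4. \<forall>a. wt n h a = wt n g (\<phi> a)"
proof -
  obtain \<pi> where \<pi>: "\<pi> permutes {..<n}" "code n h = permute_coords n \<pi> ` code n g"
    using assms(1) by (auto simp: code_equiv_def)
  define k where "k i = g (\<pi> i)" for i
  have k: "permute_coords n \<pi> (codeword n g a) = codeword n k a" "wt n k a = wt n g a" for a
    unfolding k_def using permute_codeword[OF \<pi>(1)] wt_permute[OF \<pi>(1)] by simp_all
  have injk: "inj (codeword n k)"
    using inj(1) unfolding inj_codeword_iff codeword_eq_0_iff k(2) .
  have "\<exists>b. codeword n h a = codeword n k b" for a
  proof -
    have "codeword n h a \<in> permute_coords n \<pi> ` code n g"
      unfolding \<pi>(2)[symmetric] by (simp add: code_def)
    then show ?thesis unfolding code_def image_image k(1) by blast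
  qed
  then obtain \<phi> where \<phi>: "\<And>a. codeword n h a = codeword n k (\<phi> a)" by metis
  have "additive_map \<phi>"
    unfolding additive_map_def
  proof (intro allI)
    fix a b
    have "codeword n k (\<phi> (a + b)) = codeword n k (\<phi> a + \<phi> b)" by (simp only: codeword_add flip: \<phi>)
    then show "\<phi> (a + b) = \<phi> a + \<phi> b" using injk by (simp add: inj_eq)
  qed
  moreover have "a = 0" if "\<phi> a = 0" for a
    using \<phi>[of a] that inj(2) by (simp add: codeword_0 inj_codeword_iff)
  ultimately have "\<phi> \<in> GL4" by (rule GL4_I)
  moreover have "wt n h a = wt n g (\<phi> a)" for a
    using \<phi>[of a] by (metis hamming_weight_codeword k(2))
  ultimately show ?thesis by blast
qed

text \<open>After a change of coordinates by the transpose of \<open>\<phi>\<close> both codes have the same weights, hence the same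
multiplicities of columns, hence the same columns up to order.\<close>

lemma wt_imp_code_equiv:
  assumes "\<phi> \<in> GL4" "\<And>a. wt n h a = wt n g (\<phi> a)" and inj: "inj (codeword n g)" "inj (codeword n h)"
    and nz: "\<And>i. i < n \<Longrightarrow> g i \<noteq> 0" "\<And>i. i < n \<Longrightarrow> h i \<noteq> 0"
  shows "(code n g, code n h) \<in> code_equiv n 4"
proof -
  have lin: "additive_map \<phi>" and "bij \<phi>" using assms(1) by (auto simp: GL4_def)
  define k where "k i = transpose_map \<phi> (g i)" for i
  have dot_k: "dot a (k i) = dot (\<phi> a) (g i)" for a i unfolding k_def by (rule dot_transpose[OF lin])
  have k_nz: "k i \<noteq> 0" if "i < n" for i
  proof
    assume "k i = 0"
    then have "dot (\<phi> a) (g i) = 0" for a using dot_k[of a i] by simp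
    then have "dot b (g i) = 0" for b using \<open>bij \<phi>\<close> by (metis bij_pointE)
    then show False using nz(1)[OF that] dot_eq_0_imp by blast
  qed
  have cw: "codeword n k a = codeword n g (\<phi> a)" for a by (simp add: codeword_def dot_k)
  have "wt n k a = wt n g (\<phi> a)" for a by (simp only: wt_def dot_k)
  then have "wt n h = wt n k" by (simp add: fun_eq_iff assms(2))
  then have "multiplicity_of n h x = multiplicity_of n k x" for x
    using wt_determines_multiplicity[of n h k] nz(2) k_nz by blast
  then obtain \<pi> where \<pi>: "\<pi> permutes {..<n}" "\<And>i. i < n \<Longrightarrow> h i = k (\<pi> i)"
    using permutation_if_same_multiplicity by blast
  have "codeword n h a = permute_coords n \<pi> (codeword n g (\<phi> a))" for a
  proof -
    have "codeword n h a = codeword n (\<lambda>i. k (\<pi> i)) a"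
      by (rule eq_vecI) (simp_all add: codeword_def \<pi>(2))
    then show ?thesis by (simp add: permute_codeword[OF \<pi>(1)] flip: cw)
  qed
  then have "code n h = (\<lambda>a. permute_coords n \<pi> (codeword n g a)) ` range \<phi>"
    unfolding code_def by (auto simp: image_iff)
  also have "range \<phi> = UNIV" using \<open>bij \<phi>\<close> by (simp add: bij_def)
  finally have "code n h = permute_coords n \<pi> ` code n g" by (simp add: code_def image_image)
  moreover have "binary_code n 4 (code n g)" "binary_code n 4 (code n h)"
    unfolding binary_code_4_iff using inj by blast+
  ultimately show ?thesis using \<pi>(1) by (auto simp: code_equiv_def)
qed

lemma binary_code_carrier: "binary_code n k C \<Longrightarrow> x \<in> C \<Longrightarrow> x \<in> carrier_vec n"
  unfolding binary_code_def VectorSpace.subspace_def submodule_def by (auto simp: module_vec_simps)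

lemma permute_coords_comp:
  assumes "\<pi> permutes {..<n}"
  shows "permute_coords n \<pi> (permute_coords n \<sigma> x) = permute_coords n (\<lambda>i. \<sigma> (\<pi> i)) x"
  by (rule eq_vecI) (use permutes_in_image[OF assms] in \<open>simp_all add: permute_coords_def\<close>)

lemma permute_coords_id: "x \<in> carrier_vec n \<Longrightarrow> permute_coords n (\<lambda>i. i) x = x"
  by (rule eq_vecI) (auto simp: permute_coords_def)

lemma equiv_code_equiv: "equiv {C. binary_code n k C} (code_equiv n k)"
proof (rule equivI)
  show "code_equiv n k \<subseteq> {C. binary_code n k C} \<times> {C. binary_code n k C}" by (auto simp: code_equiv_def)
  show "refl_on {C. binary_code n k C} (code_equiv n k)"
  proof (rule refl_onI)
    fix C assume "C \<in> {C. binary_code n k C}"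
    then have C: "binary_code n k C" by simp
    then have "permute_coords n (\<lambda>i. i) ` C = C"
      using binary_code_carrier permute_coords_id by (simp add: image_cong[where g = "\<lambda>x. x"])
    moreover have "(\<lambda>i. i) permutes {..<n}" using permutes_id by (simp add: id_def)
    ultimately show "(C, C) \<in> code_equiv n k" using C unfolding code_equiv_def by blast
  qed
  show "sym (code_equiv n k)"
  proof (rule symI)
    fix C D assume "(C, D) \<in> code_equiv n k"
    then obtain \<pi> where \<pi>: "\<pi> permutes {..<n}" "D = permute_coords n \<pi> ` C" and CD: "binary_code n k C" "binary_code n k D"
      by (auto simp: code_equiv_def)
    let ?\<sigma> = "inv_into UNIV \<pi>"
    have "permute_coords n ?\<sigma> (permute_coords n \<pi> x) = x" if "x \<in> C" for x
      using permute_coords_comp[OF permutes_inv[OF \<pi>(1)], of \<pi> x] permutes_inverses(1)[OF \<pi>(1)]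
        permute_coords_id[OF binary_code_carrier[OF CD(1) that]] by simp
    then have "permute_coords n ?\<sigma> ` D = C" unfolding \<pi>(2) image_image by simp
    then show "(D, C) \<in> code_equiv n k" using permutes_inv[OF \<pi>(1)] CD unfolding code_equiv_def by blast
  qed
  show "trans (code_equiv n k)"
  proof (rule transI)
    fix C D E assume "(C, D) \<in> code_equiv n k" "(D, E) \<in> code_equiv n k"
    then obtain \<pi> \<sigma> where "\<pi> permutes {..<n}" "D = permute_coords n \<pi> ` C" "\<sigma> permutes {..<n}" "E = permute_coords n \<sigma> ` D"
      and CE: "binary_code n k C" "binary_code n k E"
      by (auto simp: code_equiv_def)
    then have "E = permute_coords n (\<pi> o \<sigma>) ` C" "(\<pi> o \<sigma>) permutes {..<n}"
      by (simp_all add: image_image permute_coords_comp permutes_compose) (simp add: comp_def)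
    then show "(C, E) \<in> code_equiv n k" using CE unfolding code_equiv_def by blast
  qed
qed

section \<open>Dual distance\<close>

lemma dot_sum: "finite A \<Longrightarrow> dot a (\<Sum>i\<in>A. f i) = (\<Sum>i\<in>A. dot a (f i))"
  by (induction A rule: finite_induct) (simp_all only: sum.empty sum.insert dot_0 dot_add_right not_False_eq_True)

text \<open>The words of the dual code are the linear dependencies between the columns.\<close>

lemma indicator_in_dual_iff:
  assumes "U \<subseteq> {..<n}"
  shows "vec n (\<lambda>i. of_bool (i \<in> U)) \<in> dual_code n (code n g) \<longleftrightarrow> (\<Sum>i\<in>U. g i) = 0"
proof -
  have fin: "finite U" using assms finite_subset by blast
  have "vec n (\<lambda>i. of_bool (i \<in> U)) \<bullet> codeword n g a = dot a (\<Sum>i\<in>U. g i)" for a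
  proof -
    have "vec n (\<lambda>i. of_bool (i \<in> U)) \<bullet> codeword n g a = (\<Sum>i<n. of_bool (i \<in> U) * dot a (g i))"
      by (simp add: scalar_prod_def codeword_def lessThan_atLeast0)
    also have "\<dots> = (\<Sum>i\<in>U. dot a (g i))"
      by (rule sum.mono_neutral_cong_right) (use assms in auto)
    finally show ?thesis by (simp only: dot_sum[OF fin])
  qed
  then show ?thesis
    unfolding dual_code_def vec_module.orthogonal_complement_def code_def
    using dot_eq_0_imp dot_0(2) by (simp, metis)
qed

lemma bit_vec_eq_indicator:
  assumes "x \<in> carrier_vec n" shows "x = vec n (\<lambda>i. of_bool (i \<in> {i. i < n \<and> x $ i \<noteq> (0::bit)}))"
proof (rule eq_vecI)
  fix i assume "i < dim_vec (vec n (\<lambda>i. of_bool (i \<in> {i. i < n \<and> x $ i \<noteq> 0})) :: bit vec)"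
  then show "x $ i = vec n (\<lambda>i. of_bool (i \<in> {i. i < n \<and> x $ i \<noteq> 0})) $ i" by (cases "x $ i") simp_all
qed (simp add: carrier_vecD[OF assms])

lemma hamming_weight_indicator:
  assumes "U \<subseteq> {..<n}" shows "hamming_weight (vec n (\<lambda>i. of_bool (i \<in> U))) = card U"
  unfolding hamming_weight_def by (rule arg_cong[where f = card]) (use assms in auto)

text \<open>There are more than 16 sets of columns but only 16 points, so two sets have the same sum; their symmetric
difference sums to zero.\<close>

lemma dependent_columns:
  fixes n :: nat
  assumes "n > 4" shows "\<exists>U\<subseteq>{..<n}. U \<noteq> {} \<and> (\<Sum>i\<in>U. g i :: pt) = 0"
proof -
  let ?F = "\<lambda>S. \<Sum>i\<in>S. g i"
  have "card (?F ` Pow {..<n}) \<le> 16" using card_mono[of UNIV "?F ` Pow {..<n}"] card_UNIV_pt by simp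
  moreover have "card (Pow {..<n}) > 16"
    using power_strict_increasing[of 4 n "2::nat"] assms by (simp add: card_Pow)
  ultimately have "\<not> inj_on ?F (Pow {..<n})" by (metis card_image not_less)
  then obtain S T where ST: "S \<subseteq> {..<n}" "T \<subseteq> {..<n}" "S \<noteq> T" "?F S = ?F T" by (auto simp: inj_on_def)
  have fin: "finite S" "finite T" using ST finite_subset by blast+
  have "?F S = ?F (S - T) + ?F (S \<inter> T)" "?F T = ?F (T - S) + ?F (S \<inter> T)"
    using fin by (metis Diff_Int Int_Diff_Un add.commute finite_Diff sum.Int_Diff Int_commute)+
  then have "?F (S - T) = ?F (T - S)" using ST(4) by simp
  moreover have "?F ((S - T) \<union> (T - S)) = ?F (S - T) + ?F (T - S)"
    by (rule sum.union_disjoint) (use fin in auto)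
  ultimately have "?F ((S - T) \<union> (T - S)) = 0" by simp
  moreover have "(S - T) \<union> (T - S) \<noteq> {}" "(S - T) \<union> (T - S) \<subseteq> {..<n}" using ST by blast+
  ultimately show ?thesis by blast
qed

text \<open>A word of weight 1 in the dual code is a zero column. The bound on \<open>n\<close> provides a nonzero word in the dual code, without which
its minimum weight would not be meaningful.\<close>

lemma dual_distance_ge_2_iff:
  assumes "n > 4" shows "dual_distance n (code n g) \<ge> 2 \<longleftrightarrow> (\<forall>i<n. g i \<noteq> 0)"
proof -
  define W where "W = {card U | U. U \<subseteq> {..<n} \<and> U \<noteq> {} \<and> (\<Sum>i\<in>U. g i) = 0}"
  have "{hamming_weight x | x. x \<in> dual_code n (code n g) \<and> x \<noteq> 0\<^sub>v n} = W"
  proof (intro subset_antisym subsetI)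
    fix w assume "w \<in> {hamming_weight x | x. x \<in> dual_code n (code n g) \<and> x \<noteq> 0\<^sub>v n}"
    then obtain x where x: "w = hamming_weight x" "x \<in> dual_code n (code n g)" "x \<noteq> 0\<^sub>v n" by blast
    define U where "U = {i. i < n \<and> x $ i \<noteq> 0}"
    have U: "U \<subseteq> {..<n}" by (auto simp: U_def)
    have "x \<in> carrier_vec n" using x(2) by (simp add: dual_code_def vec_module.orthogonal_complement_def)
    then have xU: "x = vec n (\<lambda>i. of_bool (i \<in> U))" unfolding U_def by (rule bit_vec_eq_indicator)
    have "(\<Sum>i\<in>U. g i) = 0" using x(2) unfolding xU indicator_in_dual_iff[OF U] .
    moreover have "U \<noteq> {}" using x(3) unfolding xU by (auto simp: zero_vec_def)
    moreover have "w = card U" unfolding x(1) xU by (rule hamming_weight_indicator[OF U])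
    ultimately show "w \<in> W" using U unfolding W_def by blast
  next
    fix w assume "w \<in> W"
    then obtain U where U: "w = card U" "U \<subseteq> {..<n}" "U \<noteq> {}" "(\<Sum>i\<in>U. g i) = 0" unfolding W_def by blast
    let ?x = "vec n (\<lambda>i. of_bool (i \<in> U)) :: bit vec"
    obtain i where i: "i \<in> U" using U(3) by blast
    then have "?x $ i \<noteq> 0\<^sub>v n $ i" using U(2) by auto
    then have "?x \<noteq> 0\<^sub>v n" by metis
    moreover have "?x \<in> dual_code n (code n g)" using U(4) unfolding indicator_in_dual_iff[OF U(2)] .
    ultimately show "w \<in> {hamming_weight x | x. x \<in> dual_code n (code n g) \<and> x \<noteq> 0\<^sub>v n}"
      using hamming_weight_indicator[OF U(2)] U(1) by (metis (mono_tags, lifting) mem_Collect_eq)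
  qed
  then have "dual_distance n (code n g) = Min W" by (simp add: dual_distance_def min_weight_def)
  moreover have "finite W"
    by (rule finite_subset[of _ "card ` Pow {..<n}"]) (auto simp: W_def)
  moreover have "W \<noteq> {}" using dependent_columns[OF assms, of g] unfolding W_def by blast
  ultimately have "dual_distance n (code n g) \<ge> 2 \<longleftrightarrow> (\<forall>w\<in>W. 2 \<le> w)" by (simp add: Min_ge_iff)
  also have "\<dots> \<longleftrightarrow> (\<forall>i<n. g i \<noteq> 0)"
  proof
    assume W2: "\<forall>w\<in>W. 2 \<le> w"
    show "\<forall>i<n. g i \<noteq> 0"
    proof (intro allI impI notI)
      fix i assume "i < n" "g i = 0"
      then have "card {i} \<in> W" unfolding W_def by (intro CollectI exI[of _ "{i}"]) simp
      then show False using W2 by fastforce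
    qed
  next
    assume nz: "\<forall>i<n. g i \<noteq> 0"
    show "\<forall>w\<in>W. 2 \<le> w"
    proof
      fix w assume "w \<in> W"
      then obtain U where U: "w = card U" "U \<subseteq> {..<n}" "U \<noteq> {}" "(\<Sum>i\<in>U. g i) = 0" unfolding W_def by blast
      have "finite U" using U(2) finite_subset by blast
      then have "card U \<noteq> 0" using U(3) by simp
      moreover have "card U \<noteq> 1"
      proof
        assume "card U = 1"
        then obtain i where "U = {i}" by (auto simp: card_1_singleton_iff)
        then show False using U nz by auto
      qed
      ultimately show "2 \<le> w" using U(1) by linarith
    qed
  qed
  finally show ?thesis .
qed

section \<open>Isometry groups of the normal forms\<close>

text \<open>The first argument bounds the length; the cycle of \<open>a\<close> is complete when it returns to the start \<open>s\<close>.\<close>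

fun cycle_from :: "nat \<Rightarrow> ('a \<Rightarrow> 'a) \<Rightarrow> 'a \<Rightarrow> 'a \<Rightarrow> 'a list" where
  "cycle_from 0 \<phi> s a = []"
| "cycle_from (Suc n) \<phi> s a = a # (if \<phi> a = s then [] else cycle_from n \<phi> s (\<phi> a))"

definition cycles :: "(pt \<Rightarrow> pt) \<Rightarrow> pt list list" where
  "cycles \<phi> = sort_key length
     (fold (\<lambda>a cs. if a \<in> set (concat cs) then cs else cycle_from 15 \<phi> a a # cs) nonzero_points [])"

definition cycle_type :: "pt \<times> pt \<times> pt \<times> pt \<Rightarrow> nat list" where
  "cycle_type v = map length (cycles (lin v))"

text \<open>An isometry is determined by the images of the unit vectors, and these have to agree with the unit vectors in the values
of the form at single vectors and at sums of two. The filters cut off the search early.\<close>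

definition isometries :: "form_data \<Rightarrow> (pt \<times> pt \<times> pt \<times> pt) list" where
  "isometries p = (let q = form p in
     [(v1, v2, v3, v4). v1 \<leftarrow> nonzero_points, q v1 = q (1,0,0,0),
        v2 \<leftarrow> nonzero_points, q v2 = q (0,1,0,0) \<and> q (v1 + v2) = q (1,1,0,0),
        v3 \<leftarrow> nonzero_points, q v3 = q (0,0,1,0) \<and> q (v1 + v3) = q (1,0,1,0) \<and> q (v2 + v3) = q (0,1,1,0),
        v4 \<leftarrow> nonzero_points, q v4 = q (0,0,0,1) \<and> q (v1 + v4) = q (1,0,0,1) \<and> q (v2 + v4) = q (0,1,0,1) \<and> q (v3 + v4) = q (0,0,1,1)])"

definition covers_nonzero :: "pt list list \<Rightarrow> bool" where
  "covers_nonzero cs \<longleftrightarrow> length (concat cs) = 15 \<and> 0 \<notin> set (concat cs)"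

definition preserves :: "form_data \<Rightarrow> (pt \<Rightarrow> pt) \<Rightarrow> bool" where
  "preserves p \<phi> \<longleftrightarrow> map (\<lambda>a. form p (\<phi> a)) points = map (form p) points"

text \<open>Conversely, each quadruple found is checked to give an isometry: the cycles cover all nonzero points, which makes the
map bijective, and the form is preserved everywhere.\<close>

definition isometry_check :: "form_data \<Rightarrow> pt \<times> pt \<times> pt \<times> pt \<Rightarrow> bool" where
  "isometry_check p v \<longleftrightarrow> permutes_cycles (lin v) (cycles (lin v)) \<and> covers_nonzero (cycles (lin v)) \<and> preserves p (lin v)"

fun bump :: "'a \<Rightarrow> ('a \<times> nat) list \<Rightarrow> ('a \<times> nat) list" where
  "bump x [] = [(x, 1)]"
| "bump x ((y, m) # T) = (if x = y then (y, Suc m) # T else (y, m) # bump x T)"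

definition tally :: "'a list \<Rightarrow> ('a \<times> nat) list" where
  "tally xs = foldr bump xs []"


lemma sum_list_tally: "(\<Sum>(t, m)\<leftarrow>tally xs. int m * h t) = (\<Sum>x\<leftarrow>xs. h x)"
proof -
  have bump: "(\<Sum>(t, m)\<leftarrow>bump x T. int m * h t) = h x + (\<Sum>(t, m)\<leftarrow>T. int m * h t)" for x T
    by (induction x T rule: bump.induct) (auto simp: algebra_simps)
  show ?thesis unfolding tally_def by (induction xs) (simp_all add: bump)
qed

text \<open>The table lists cycle types with the number of isometries that have them, so the denominator is the order of the group.\<close>

definition burnside_average :: "(nat list \<times> nat) list \<Rightarrow> nat \<Rightarrow> int" where
  "burnside_average T k = (\<Sum>(t, m)\<leftarrow>T. int m * num_constant_on_blocks t k) div (\<Sum>(t, m)\<leftarrow>T. int m)"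

definition isometry_group :: "form_data \<Rightarrow> (pt \<Rightarrow> pt) set" where
  "isometry_group p = {\<phi> \<in> GL4. \<forall>a. form p (\<phi> a) = form p a}"

text \<open>The functions \<open>f\<close> that distribute \<open>k\<close> additional units, each worth weight 4, over the nonzero points.\<close>

definition distributions :: "nat \<Rightarrow> (pt \<Rightarrow> nat) set" where
  "distributions k = {f. f 0 = 0 \<and> (\<Sum>a\<in>UNIV. f a) = k}"

lemma isometries_iff:
  "(v1, v2, v3, v4) \<in> set (isometries p) \<longleftrightarrow> v1 \<noteq> 0 \<and> v2 \<noteq> 0 \<and> v3 \<noteq> 0 \<and> v4 \<noteq> 0 \<and>
    form p v1 = form p (1,0,0,0) \<and> form p v2 = form p (0,1,0,0) \<and> form p v3 = form p (0,0,1,0) \<and> form p v4 = form p (0,0,0,1) \<and>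
    form p (v1 + v2) = form p (1,1,0,0) \<and> form p (v1 + v3) = form p (1,0,1,0) \<and> form p (v1 + v4) = form p (1,0,0,1) \<and>
    form p (v2 + v3) = form p (0,1,1,0) \<and> form p (v2 + v4) = form p (0,1,0,1) \<and> form p (v3 + v4) = form p (0,0,1,1)"
  unfolding isometries_def Let_def by (simp add: set_nonzero_points) blast

text \<open>The filters in the enumeration are values of the form that an isometry preserves.\<close>

lemma isometry_group_subset: "isometry_group p \<subseteq> lin ` set (isometries p)"
proof
  fix \<phi> assume "\<phi> \<in> isometry_group p"
  then have \<phi>: "\<phi> \<in> GL4" "\<And>a. form p (\<phi> a) = form p a" by (auto simp: isometry_group_def)
  then have lin: "additive_map \<phi>" by (simp add: GL4_def)
  have "(\<phi> (1,0,0,0), \<phi> (0,1,0,0), \<phi> (0,0,1,0), \<phi> (0,0,0,1)) \<in> set (isometries p)"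
    unfolding isometries_iff additive_map_add[OF lin, symmetric] \<phi>(2) GL4_eq_0_iff[OF \<phi>(1)]
    by (simp add: zero_prod_def)
  then show "\<phi> \<in> lin ` set (isometries p)" using additive_map_eq_lin[OF lin] by blast
qed

lemma isometry_checkD:
  assumes "isometry_check p v"
  shows "lin v \<in> isometry_group p" "permutes_cycles (lin v) (cycles (lin v))" "set (concat (cycles (lin v))) = - {0}"
proof -
  let ?cs = "cycles (lin v)"
  show perm: "permutes_cycles (lin v) ?cs" using assms by (simp add: isometry_check_def)
  have "card (set (concat ?cs)) = 15" "set (concat ?cs) \<subseteq> - {0}"
    using assms distinct_card[of "concat ?cs"] unfolding isometry_check_def covers_nonzero_def permutes_cycles_def by auto
  moreover have "card (- {0 :: pt}) = 15" by (simp add: card_Diff_subset Compl_eq_Diff_UNIV card_UNIV_pt)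
  ultimately show cov: "set (concat ?cs) = - {0}" by (intro card_subset_eq) simp_all
  have "lin v a \<noteq> 0" if "a \<noteq> 0" for a
  proof -
    have "a \<in> set (concat ?cs)" using that cov by blast
    then obtain c where c: "c \<in> set ?cs" "a \<in> set c" by auto
    have "map (lin v) c = rotate1 c" using perm c(1) by (simp add: permutes_cycles_def list_all_iff)
    then have "lin v ` set c = set c" by (metis set_map set_rotate1)
    then have "lin v a \<in> set (concat ?cs)" using c by auto
    then show ?thesis using cov by blast
  qed
  then have "lin v \<in> GL4" using GL4_I[OF additive_map_lin] by blast
  then show "lin v \<in> isometry_group p"
    using assms set_points by (auto simp: isometry_group_def isometry_check_def preserves_def)
qed

lemma isometry_group_inv:
  assumes "\<phi> \<in> isometry_group p"
  shows "inv_into UNIV \<phi> \<in> isometry_group p" "\<phi> o inv_into UNIV \<phi> = id"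
proof -
  have \<phi>: "\<phi> \<in> GL4" "\<And>a. form p (\<phi> a) = form p a" using assms unfolding isometry_group_def by blast+
  have surj: "surj \<phi>" using \<phi>(1) by (simp add: GL4_def bij_def)
  have "form p (inv_into UNIV \<phi> a) = form p a" for a
    using \<phi>(2)[of "inv_into UNIV \<phi> a"] surj_f_inv_f[OF surj, of a] by simp
  then show "inv_into UNIV \<phi> \<in> isometry_group p" using GL4_inv[OF \<phi>(1)] unfolding isometry_group_def by blast
  show "\<phi> o inv_into UNIV \<phi> = id" using surj by (simp add: fun_eq_iff surj_f_inv_f)
qed

lemma isometry_group_comp:
  "\<phi> \<in> isometry_group p \<Longrightarrow> \<psi> \<in> isometry_group p \<Longrightarrow> \<phi> o \<psi> \<in> isometry_group p"
  using GL4_comp unfolding isometry_group_def by simp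

lemma card_fixed_distributions:
  assumes "isometry_check p v"
  shows "int (card {f \<in> distributions k. f o lin v = f}) = num_constant_on_blocks (cycle_type v) k"
proof -
  let ?cs = "cycles (lin v)"
  note check = isometry_checkD[OF assms]
  have fix_iff: "f o lin v = f \<longleftrightarrow> (\<forall>c\<in>set ?cs. \<forall>a\<in>set c. \<forall>b\<in>set c. f a = f b)" for f :: "pt \<Rightarrow> nat"
  proof (rule invariant_iff_constant_on_cycles[OF check(2)])
    show "lin v a = a" if "a \<notin> set (concat ?cs)" for a
      using that additive_map_0[OF additive_map_lin, of v] unfolding check(3) by simp
  qed
  have sum: "(\<Sum>a\<in>UNIV. f a) = (\<Sum>a\<in>-{0}. f a)" if "f 0 = 0" for f :: "pt \<Rightarrow> nat"
    by (rule sum.mono_neutral_right) (use that in auto)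
  have "{f \<in> distributions k. f o lin v = f} = block_functions ?cs k"
    unfolding distributions_def block_functions_def fix_iff check(3) using sum by auto
  then show ?thesis
    using card_block_functions[of ?cs k] check(2) by (simp add: permutes_cycles_def cycle_type_def)
qed

lemma finite_distributions: "finite (distributions k)"
proof -
  have "finite {f :: pt \<Rightarrow> nat. \<forall>x. (x \<in> UNIV \<longrightarrow> f x \<in> {..k}) \<and> (x \<notin> UNIV \<longrightarrow> f x = 0)}"
    by (rule finite_set_of_finite_funs) simp_all
  moreover have le: "f x \<le> k" if "f \<in> distributions k" for f x
    using that member_le_sum[of x UNIV f] by (simp add: distributions_def)
  ultimately show ?thesis by (elim rev_finite_subset) (auto intro: le)
qed

definition table_ok :: "form_data \<times> (nat list \<times> nat) list \<Rightarrow> bool" where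
  "table_ok = (\<lambda>(p, T). distinct (isometries p) \<and> list_all (isometry_check p) (isometries p) \<and>
     tally (map cycle_type (isometries p)) = T)"

lemma card_orbits_distributions:
  assumes "table_ok (p, T)"
  shows "int (card (orbits_under (isometry_group p) (distributions k))) = burnside_average T k"
proof -
  let ?G = "isometry_group p"
  have check: "isometry_check p v" if "v \<in> set (isometries p)" for v
    using assms that by (simp add: table_ok_def list_all_iff)
  have dist: "distinct (isometries p)" and T: "tally (map cycle_type (isometries p)) = T"
    using assms by (simp_all add: table_ok_def)
  have G: "?G = lin ` set (isometries p)"
    using isometry_group_subset isometry_checkD(1)[OF check] by blast
  have inj: "inj_on lin (set (isometries p))" using inj_lin inj_on_subset by blast
  have card_G: "int (card ?G) = (\<Sum>(t, m)\<leftarrow>T. int m)"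
    using sum_list_tally[of "\<lambda>_. 1" "map cycle_type (isometries p)"] distinct_card[OF dist]
    by (simp add: G card_image[OF inj] T comp_def sum_list_triv)
  have "(\<Sum>\<phi>\<in>?G. int (card {f \<in> distributions k. f o \<phi> = f})) =
      (\<Sum>v\<in>set (isometries p). int (card {f \<in> distributions k. f o lin v = f}))"
    unfolding G by (subst sum.reindex[OF inj]) (simp add: comp_def)
  also have "\<dots> = (\<Sum>v\<in>set (isometries p). num_constant_on_blocks (cycle_type v) k)"
    by (rule sum.cong) (simp_all only: card_fixed_distributions[OF check])
  also have "\<dots> = (\<Sum>(t, m)\<leftarrow>T. int m * num_constant_on_blocks t k)"
    using sum_list_tally[of "\<lambda>t. num_constant_on_blocks t k" "map cycle_type (isometries p)"]
    unfolding sum_list_distinct_conv_sum_set[OF dist, symmetric] by (simp add: T comp_def)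
  finally have fixed: "(\<Sum>\<phi>\<in>?G. int (card {f \<in> distributions k. f o \<phi> = f})) = (\<Sum>(t, m)\<leftarrow>T. int m * num_constant_on_blocks t k)" .
  have "card (orbits_under ?G (distributions k)) * card ?G = (\<Sum>\<phi>\<in>?G. card {f \<in> distributions k. f o \<phi> = f})"
  proof (rule burnside_precomposition)
    show "finite ?G" by (simp add: G)
    show "finite (distributions k)" by (rule finite_distributions)
    show "id \<in> ?G" by (simp add: isometry_group_def GL4_id)
    show "\<phi> o \<psi> \<in> ?G" if "\<phi> \<in> ?G" "\<psi> \<in> ?G" for \<phi> \<psi>
      using that by (rule isometry_group_comp)
    show "\<exists>\<psi>\<in>?G. \<phi> o \<psi> = id" if \<phi>: "\<phi> \<in> ?G" for \<phi>
      using isometry_group_inv[OF \<phi>] by blast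
    show "f o \<phi> \<in> distributions k" if "f \<in> distributions k" "\<phi> \<in> ?G" for f \<phi>
    proof -
      have \<phi>: "\<phi> \<in> GL4" "bij \<phi>" using that(2) by (simp_all add: isometry_group_def GL4_def)
      then have "(\<Sum>a\<in>UNIV. f (\<phi> a)) = (\<Sum>a\<in>UNIV. f a)" by (intro sum.reindex_bij_betw) simp
      then show ?thesis using that(1) GL4_eq_0_iff[OF \<phi>(1), of 0] by (simp add: distributions_def)
    qed
  qed
  then have "int (card (orbits_under ?G (distributions k))) * (\<Sum>(t, m)\<leftarrow>T. int m) = (\<Sum>(t, m)\<leftarrow>T. int m * num_constant_on_blocks t k)"
    unfolding card_G[symmetric] fixed[symmetric] of_nat_mult[symmetric] of_nat_sum[symmetric] by (rule arg_cong)
  moreover have "(\<Sum>(t, m)\<leftarrow>T. int m) \<noteq> 0"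
  proof -
    have "id \<in> ?G" by (simp add: isometry_group_def GL4_id)
    then have "card ?G \<noteq> 0" by (metis G List.finite_set card_eq_0_iff empty_iff finite_imageI)
    then show ?thesis unfolding card_G[symmetric] by simp
  qed
  ultimately show ?thesis unfolding burnside_average_def by (metis nonzero_mult_div_cancel_right)
qed

text \<open>The cycle types on the fifteen nonzero points of the isometries of each normal form, with their frequencies.\<close>

definition cycle_table :: "(form_data \<times> (nat list \<times> nat) list) list" where
  "cycle_table =
    [((True, 0, 0, 0, 0), [([1,2,3,3,6], 12), ([1,1,1,3,3,3,3], 4), ([1,1,1,2,2,2,2,2,2], 15), ([1,1,1,1,1,1,1,2,2,2,2], 6),
        ([1,2,4,4,4], 18), ([3,6,6], 12), ([3,3,3,3,3], 4), ([1,1,1,1,1,1,1,1,1,1,1,1,1,1,1], 1)]),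
     ((True, 0, 0, 2, 2), [([5,5,5], 24), ([1,2,3,3,6], 20), ([1,2,4,4,4], 30), ([1,1,1,2,2,2,2,2,2], 15),
        ([1,1,1,3,3,3,3], 20), ([1,1,1,1,1,1,1,2,2,2,2], 10), ([1,1,1,1,1,1,1,1,1,1,1,1,1,1,1], 1)]),
     ((False, 1, 1, 1, 1), [([1,1,1,1,1,1,1,1,1,1,1,1,1,1,1], 1), ([1,1,1,1,1,1,1,2,2,2,2], 6), ([1,1,1,3,3,3,3], 8),
        ([1,1,1,2,2,2,2,2,2], 3), ([1,2,4,4,4], 6)]),
     ((False, 1, 1, 1, 3), [([1,1,1,2,2,2,2,2,2], 3), ([1,2,3,3,6], 2), ([1,1,1,1,1,1,1,1,1,1,1,1,1,1,1], 1),
        ([1,1,1,1,1,1,1,2,2,2,2], 4), ([1,1,1,3,3,3,3], 2)]),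
     ((False, 1, 1, 3, 3), [([1,1,1,2,2,2,2,2,2], 3), ([1,2,4,4,4], 2), ([1,1,1,1,1,1,1,1,1,1,1,1,1,1,1], 1),
        ([1,1,1,1,1,1,1,2,2,2,2], 2)]),
     ((False, 1, 3, 3, 3), [([1,1,1,1,1,1,1,1,1,1,1,1,1,1,1], 1), ([1,1,1,1,1,1,1,2,2,2,2], 4), ([1,1,1,3,3,3,3], 2),
        ([1,1,1,2,2,2,2,2,2], 3), ([1,2,3,3,6], 2)])]"

lemma cycle_table_ok: "list_all table_ok cycle_table"
  by code_simp

section \<open>Admissible parameters\<close>

text \<open>The total by which the weights have to exceed a common lower bound congruent to \<open>c\<close> modulo 4 in order to be congruent
to the form.\<close>

definition residue_sum :: "int \<Rightarrow> form_data \<Rightarrow> int" where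
  "residue_sum c p = (\<Sum>a\<leftarrow>nonzero_points. (form p a - c) mod 4)"

definition contribution :: "int \<Rightarrow> int \<Rightarrow> form_data \<times> (nat list \<times> nat) list \<Rightarrow> int" where
  "contribution E c = (\<lambda>(p, T). if residue_sum c p \<le> E then burnside_average T (nat ((E - residue_sum c p) div 4)) else 0)"

text \<open>For admissible parameters, the number of classes of LCD codes without zero columns whose minimum weight \<open>D\<close> is congruent to \<open>c\<close> modulo 4
and for which \<open>8 * n = 15 * D + E\<close>.
A normal form contributes if its residues leave a nonnegative remainder of \<open>E\<close>, to be distributed in units of 4.\<close>

definition class_total :: "int \<Rightarrow> int \<Rightarrow> int" where
  "class_total E c = sum_list (map (contribution E c) cycle_table)"

text \<open>The multiplicity of the point \<open>x\<close> as a column is nonnegative for each distribution of the remainder: four times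
this multiplicity is the sum of the weights over the points with inner product 1 with \<open>x\<close>, minus \<open>4 * n\<close>.
Here \<open>4 * n\<close> is half of \<open>15 * D + E\<close>, and \<open>8 * D\<close> is part of the sum.\<close>

definition hyperplane_ok :: "int \<Rightarrow> int \<Rightarrow> int \<Rightarrow> form_data \<Rightarrow> pt \<Rightarrow> bool" where
  "hyperplane_ok E c D p x \<longleftrightarrow> E \<le> 2 * (\<Sum>a\<leftarrow>nonzero_points. of_bool (dot a x = 1) * ((form p a - c) mod 4)) + D"

text \<open>The first inequality excludes a larger minimum weight: raising \<open>D\<close> by 1 lowers \<open>E\<close> by 15.\<close>

definition form_ok :: "int \<Rightarrow> int \<Rightarrow> int \<Rightarrow> form_data \<Rightarrow> bool" where
  "form_ok E c D p \<longleftrightarrow> E < residue_sum (c + 1) p + 15 \<and>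
     (if residue_sum c p \<le> E then (E - residue_sum c p) mod 4 = 0 \<and> list_all (hyperplane_ok E c D p) nonzero_points else True)"

definition parameters_ok :: "int \<Rightarrow> int \<Rightarrow> int \<Rightarrow> bool" where
  "parameters_ok E c D \<longleftrightarrow> list_all (form_ok E c D) normal_forms \<and> list_ex (\<lambda>p. residue_sum c p \<le> E) normal_forms"

text \<open>Divisibility by 4 makes the multiplicities of the columns integers.\<close>

definition divisible_at :: "form_data \<Rightarrow> pt \<Rightarrow> bool" where
  "divisible_at p x \<longleftrightarrow> (\<Sum>a\<leftarrow>nonzero_points. of_bool (dot a x = 1) * form p a) mod 4 = 0"

definition divisible_form :: "form_data \<Rightarrow> bool" where
  "divisible_form p \<longleftrightarrow> list_all (divisible_at p) nonzero_points"

lemma divisible_forms: "list_all divisible_form normal_forms"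
  by code_simp

section \<open>Codes with prescribed weights\<close>

lemma sum_list_nonzero_points: "(\<Sum>a\<leftarrow>nonzero_points. f a) = (\<Sum>a\<in>-{0}. f a)"
  for f :: "pt \<Rightarrow> int"
  by (simp add: sum_list_distinct_conv_sum_set[OF distinct_nonzero_points] set_nonzero_points)

lemma residue_sum_eq: "residue_sum c p = (\<Sum>a\<in>-{0}. (form p a - c) mod 4)"
  unfolding residue_sum_def sum_list_nonzero_points ..

lemma card_Compl_0: "card (- {0 :: pt}) = 15"
  by (simp add: Compl_eq_Diff_UNIV card_UNIV_pt)

lemma form_0 [simp]: "form p 0 = 0"
  by (cases p) (simp add: form_def zero_prod_def)

lemma form_mod_4 [simp]: "form p a mod 4 = form p a"
  by (cases p; cases a) (simp only: form_def prod.case mod_mod_trivial)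

definition has_weights :: "nat \<Rightarrow> nat \<Rightarrow> form_data \<Rightarrow> (pt \<Rightarrow> nat) \<Rightarrow> (nat \<Rightarrow> pt) \<Rightarrow> bool" where
  "has_weights n D p f g \<longleftrightarrow> (\<forall>i<n. g i \<noteq> 0) \<and>
     (\<forall>a. a \<noteq> 0 \<longrightarrow> int (wt n g a) = int D + (form p a - int D) mod 4 + 4 * int (f a))"

lemma has_weights_mod_4: assumes "has_weights n D p f g" shows "int (wt n g a) mod 4 = form p a"
proof (cases "a = 0")
  case False
  then have "int (wt n g a) mod 4 = (int D + (form p a - int D) mod 4) mod 4"
    using assms by (simp add: has_weights_def)
  also have "\<dots> = form p a" by (simp add: mod_add_right_eq)
  finally show ?thesis .
qed simp

lemma has_weights_nondegenerate:
  assumes "has_weights n D p f g" "p \<in> set normal_forms" shows "nondegenerate_gram n g"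
  unfolding nondegenerate_gram_def
proof (intro allI impI)
  fix a :: pt assume "a \<noteq> 0"
  then obtain b where b: "(form p (a + b) - form p a - form p b) mod 4 \<noteq> 0" using form_nondegenerate assms(2) by blast
  have "gram n g a b \<noteq> 0"
  proof
    assume "gram n g a b = 0"
    then have "int (wt n g (a + b)) mod 4 = (int (wt n g a) + int (wt n g b)) mod 4" by (simp add: wt_add_mod_4)
    also have "\<dots> = (form p a + form p b) mod 4"
      unfolding has_weights_mod_4[OF assms(1), symmetric] by (rule mod_add_eq[symmetric])
    finally have "form p (a + b) mod 4 = (form p a + form p b) mod 4"
      unfolding has_weights_mod_4[OF assms(1)] by simp
    then have "4 dvd form p (a + b) - (form p a + form p b)" by (simp only: mod_eq_dvd_iff)
    then have "(form p (a + b) - form p a - form p b) mod 4 = 0" by (simp add: diff_diff_eq mod_eq_0_iff_dvd)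
    then show False using b by contradiction
  qed
  then show "\<exists>b. gram n g a b = 1" by (metis bit_not_zero_iff)
qed

lemma mod_4_decompose: fixes w D f :: int
  assumes "D \<le> w" "w mod 4 = f mod 4" shows "w = D + (f - D) mod 4 + 4 * ((w - D) div 4)"
proof -
  have "(f - D) mod 4 = (w - D) mod 4" using assms(2) by (metis mod_diff_left_eq)
  then show ?thesis using mult_div_mod_eq[of 4 "w - D"] by linarith
qed

lemma residue_le: fixes w D f :: int
  assumes "D \<le> w" "w mod 4 = f mod 4" shows "D + (f - D) mod 4 \<le> w"
proof -
  have "0 \<le> (w - D) div 4" using assms(1) by (simp add: pos_imp_zdiv_nonneg_iff)
  then show ?thesis using mod_4_decompose[OF assms] by linarith
qed

text \<open>Zero columns are permitted here: they only lower the sum of the weights.\<close>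

lemma no_larger_minimum_weight:
  assumes "nondegenerate_gram n g" "\<And>a. a \<noteq> 0 \<Longrightarrow> D < wt n g a" "8 * int n = 15 * int D + E"
  shows "\<exists>p\<in>set normal_forms. residue_sum (int D + 1) p + 15 \<le> E"
proof -
  interpret nondegenerate_form "\<lambda>a. int (wt n g a)" "gram n g" by (rule nondegenerate_form_wt[OF assms(1)])
  obtain p \<phi> where p: "p \<in> set normal_forms" "\<phi> \<in> GL4" "\<And>a. int (wt n g (\<phi> a)) mod 4 = form p a"
    using normal_form by blast
  have "bij \<phi>" using p(2) by (simp add: GL4_def)
  have "(\<Sum>a\<in>-{0}. int D + 1 + (form p a - (int D + 1)) mod 4) \<le> (\<Sum>a\<in>-{0}. int (wt n g (\<phi> a)))"
  proof (rule sum_mono)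
    fix a :: pt assume "a \<in> - {0}"
    then have "D < wt n g (\<phi> a)" using assms(2) GL4_eq_0_iff[OF p(2)] by simp
    then show "int D + 1 + (form p a - (int D + 1)) mod 4 \<le> int (wt n g (\<phi> a))"
      by (intro residue_le) (simp_all add: p(3))
  qed
  also have "\<dots> = (\<Sum>a\<in>UNIV. int (wt n g (\<phi> a)))"
    by (rule sum_nonzero[symmetric]) (simp add: GL4_eq_0_iff[OF p(2), of 0, THEN iffD2])
  also have "\<dots> = (\<Sum>a\<in>UNIV. int (wt n g a))" using \<open>bij \<phi>\<close> by (rule sum.reindex_bij_betw)
  also have "\<dots> = 8 * int (card {i. i < n \<and> g i \<noteq> 0})" by (rule sum_wt)
  also have "\<dots> \<le> 8 * int n" using card_mono[of "{..<n}" "{i. i < n \<and> g i \<noteq> 0}"] by fastforce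
  finally have "15 * (int D + 1) + residue_sum (int D + 1) p \<le> 8 * int n"
    by (simp add: sum.distrib residue_sum_eq card_Compl_0)
  then show ?thesis using p(1) assms(3) by force
qed

text \<open>The multiplicities \<open>m\<close> of the columns are obtained from the weights \<open>w\<close> by inverting \<open>transform\<close>, as \<open>w\<close> has the sum \<open>8 * n\<close>.\<close>

lemma exists_columns_with_weights:
  fixes n D k :: nat and E :: int
  assumes p: "p \<in> set normal_forms" and f: "f \<in> distributions k"
    and n: "8 * int n = 15 * int D + E" and k: "residue_sum (int D) p + 4 * int k = E"
    and hyperplanes: "\<And>x. x \<noteq> 0 \<Longrightarrow> E \<le> 2 * (\<Sum>a\<in>-{0}. of_bool (dot a x = 1) * ((form p a - int D) mod 4)) + int D"
  shows "\<exists>g. has_weights n D p f g"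
proof -
  define w where "w a = (if a = 0 then 0 else int D + (form p a - int D) mod 4 + 4 * int (f a))" for a
  have w_0: "w 0 = 0" by (simp add: w_def)
  have f_sum: "(\<Sum>a\<in>-{0}. int (f a)) = int k"
    using f sum_nonzero[of f] unfolding distributions_def by (simp flip: of_nat_sum)
  have w_sum: "(\<Sum>a\<in>-{0}. w a) = 8 * int n"
  proof -
    have "(\<Sum>a\<in>-{0}. w a) = (\<Sum>a\<in>-{0}. int D + (form p a - int D) mod 4 + 4 * int (f a))"
      by (rule sum.cong) (simp_all add: w_def)
    also have "\<dots> = 15 * int D + residue_sum (int D) p + 4 * int k"
      by (simp add: sum.distrib card_Compl_0 residue_sum_eq f_sum flip: sum_distrib_left)
    finally show ?thesis using n k by simp
  qed
  have tw: "transform w x = (\<Sum>a\<in>-{0}. of_bool (dot a x = 1) * w a)" for x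
    unfolding transform_def by (subst sum_nonzero) (simp_all add: w_0 dot_commute[of x])
  have card8: "(\<Sum>a\<in>-{0}. of_bool (dot a x = 1)) = (8 :: int)" if "x \<noteq> 0" for x
  proof -
    have "(\<Sum>a\<in>-{0}. of_bool (dot a x = 1) :: int) = (\<Sum>a\<in>UNIV. of_bool (dot a x = 1))"
      by (rule sum_nonzero[symmetric]) simp
    also have "\<dots> = int (card {a. dot a x = 1})" by (simp add: sum_of_bool_eq)
    finally show ?thesis using card_common[OF that that] by simp
  qed
  have dvd: "4 dvd transform w x" if x: "x \<noteq> 0" for x
  proof -
    have "divisible_at p x" using divisible_forms p x by (simp add: list_all_iff divisible_form_def set_nonzero_points)
    then have "4 dvd (\<Sum>a\<in>-{0}. of_bool (dot a x = 1) * form p a)"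
      unfolding divisible_at_def sum_list_nonzero_points by (simp add: mod_eq_0_iff_dvd)
    moreover have "4 dvd (\<Sum>a\<in>-{0}. of_bool (dot a x = 1) * (w a - form p a))"
    proof (rule dvd_sum)
      fix a :: pt assume "a \<in> - {0}"
      then have "w a mod 4 = form p a mod 4"
        by (simp add: w_def mod_add_right_eq)
      then show "4 dvd of_bool (dot a x = 1) * (w a - form p a)" by (simp only: mod_eq_dvd_iff dvd_mult)
    qed
    ultimately have "4 dvd (\<Sum>a\<in>-{0}. of_bool (dot a x = 1) * form p a) + (\<Sum>a\<in>-{0}. of_bool (dot a x = 1) * (w a - form p a))"
      by (rule dvd_add)
    then show ?thesis unfolding tw sum.distrib[symmetric] by (simp add: algebra_simps)
  qed
  have ge: "4 * int n \<le> transform w x" if x: "x \<noteq> 0" for x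
  proof -
    let ?r = "\<lambda>a. (form p a - int D) mod 4"
    have "(\<Sum>a\<in>-{0}. of_bool (dot a x = 1) * int D + of_bool (dot a x = 1) * ?r a) \<le> transform w x"
      unfolding tw by (rule sum_mono) (simp add: w_def)
    then have "8 * int D + (\<Sum>a\<in>-{0}. of_bool (dot a x = 1) * ?r a) \<le> transform w x"
      by (simp only: sum.distrib sum_distrib_right[symmetric] card8[OF x])
    then show ?thesis using hyperplanes[OF x] n by linarith
  qed
  define m where "m x = (if x = 0 then 0 else (transform w x - 4 * int n) div 4)" for x
  have m4: "4 * m x = transform w x - 4 * int n" if "x \<noteq> 0" for x
    using dvd[OF that] by (simp add: m_def that)
  have m_ge: "0 \<le> m x" for x using ge[of x] m4[of x] by (cases "x = 0") (simp add: m_def, linarith)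
  have m_0: "m 0 = 0" by (simp add: m_def)
  have m_sum: "(\<Sum>x\<in>-{0}. m x) = int n"
  proof -
    have "4 * (\<Sum>x\<in>-{0}. m x) = (\<Sum>x\<in>-{0}. transform w x - 4 * int n)"
      unfolding sum_distrib_left by (rule sum.cong) (simp_all add: m4)
    also have "\<dots> = (\<Sum>x\<in>UNIV. transform w x) - 60 * int n"
      by (simp add: sum_subtractf card_Compl_0 sum_nonzero)
    also have "\<dots> = 4 * int n" by (simp add: sum_transform w_sum)
    finally show ?thesis by simp
  qed
  have tm: "transform m a = w a" if a: "a \<noteq> 0" for a
  proof -
    have "transform m a = (\<Sum>x\<in>-{0}. of_bool (dot a x = 1) * m x)"
      unfolding transform_def by (rule sum_nonzero) simp
    then have "4 * transform m a = (\<Sum>x\<in>-{0}. of_bool (dot a x = 1) * (4 * m x))"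
      by (simp only: sum_distrib_left mult.left_commute)
    also have "\<dots> = (\<Sum>x\<in>-{0}. of_bool (dot a x = 1) * transform w x - of_bool (dot x a = 1) * (4 * int n))"
      by (rule sum.cong) (simp_all add: m4 right_diff_distrib dot_commute[of a])
    also have "\<dots> = transform (transform w) a - 8 * (4 * int n)"
    proof -
      have "transform (transform w) a = (\<Sum>x\<in>-{0}. of_bool (dot a x = 1) * transform w x)"
        unfolding transform_def[of "transform w"] by (rule sum_nonzero) simp
      then show ?thesis by (simp only: sum_subtractf sum_distrib_right[symmetric] card8[OF a])
    qed
    also have "\<dots> = 4 * w a" unfolding transform_transform[OF a] w_sum by simp
    finally show ?thesis by simp
  qed
  have "(\<Sum>x\<in>UNIV. nat (m x)) = n"
  proof -
    have "int (\<Sum>x\<in>UNIV. nat (m x)) = (\<Sum>x\<in>UNIV. m x)" unfolding of_nat_sum by (rule sum.cong) (simp_all add: m_ge)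
    then show ?thesis using m_sum sum_nonzero[of m, OF m_0] by linarith
  qed
  then obtain g where g: "\<And>x. multiplicity_of n g x = nat (m x)" using exists_columns by blast
  have "g i \<noteq> 0" if "i < n" for i
  proof
    assume "g i = 0"
    then have "i \<in> {i. i < n \<and> g i = 0}" using that by simp
    moreover have "card {i. i < n \<and> g i = 0} = 0" using g[of 0] m_0 by (simp add: multiplicity_of_def)
    moreover have "finite {i. i < n \<and> g i = 0}" by simp
    ultimately show False by (metis card_eq_0_iff empty_iff)
  qed
  moreover have "int (wt n g a) = w a" if "a \<noteq> 0" for a
  proof -
    have "int (wt n g a) = transform m a" unfolding wt_eq_transform g using m_ge by (simp add: fun_eq_iff)
    then show ?thesis using tm that by simp
  qed
  ultimately show ?thesis unfolding has_weights_def w_def by (intro exI[of _ g]) simp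
qed

text \<open>Weights modulo 4 recover the form, so a bijection between the weights is an isometry of normal forms.\<close>

lemma equivalent_iff_isometric:
  assumes g: "has_weights n D p f g" and g': "has_weights n D p' f' g'"
    and p: "p \<in> set normal_forms" "p' \<in> set normal_forms" and f: "f 0 = 0" "f' 0 = 0"
  shows "(code n g, code n g') \<in> code_equiv n 4 \<longleftrightarrow> p = p' \<and> (\<exists>\<phi>\<in>isometry_group p. f' = f o \<phi>)"
proof -
  have inj: "inj (codeword n g)" "inj (codeword n g')"
    using has_weights_nondegenerate inj_codeword_if_nondegenerate g g' p by blast+
  show ?thesis
  proof
    assume "(code n g, code n g') \<in> code_equiv n 4"
    then obtain \<phi> where \<phi>: "\<phi> \<in> GL4" "\<And>a. wt n g' a = wt n g (\<phi> a)" using code_equiv_imp_wt inj by blast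
    have form: "form p (\<phi> a) = form p' a" for a
      using \<phi>(2)[of a] has_weights_mod_4[OF g, of "\<phi> a"] has_weights_mod_4[OF g', of a] by simp
    then have "p = p'" using normal_form_unique p \<phi>(1) by blast
    moreover have "\<phi> \<in> isometry_group p" using \<phi>(1) form calculation by (simp add: isometry_group_def)
    moreover have "f' = f o \<phi>"
    proof
      fix a
      show "f' a = (f o \<phi>) a"
      proof (cases "a = 0")
        case True
        then show ?thesis using f GL4_eq_0_iff[OF \<phi>(1), of 0] by simp
      next
        case False
        then have "int D + (form p' a - int D) mod 4 + 4 * int (f' a) = int D + (form p (\<phi> a) - int D) mod 4 + 4 * int (f (\<phi> a))"
          using g g' \<phi>(2)[of a] GL4_eq_0_iff[OF \<phi>(1), of a] unfolding has_weights_def by metis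
        then show ?thesis unfolding form by simp
      qed
    qed
    ultimately show "p = p' \<and> (\<exists>\<phi>\<in>isometry_group p. f' = f o \<phi>)" by blast
  next
    assume "p = p' \<and> (\<exists>\<phi>\<in>isometry_group p. f' = f o \<phi>)"
    then obtain \<phi> where \<phi>: "p = p'" "\<phi> \<in> GL4" "\<And>a. form p (\<phi> a) = form p a" "f' = f o \<phi>"
      unfolding isometry_group_def by blast
    have "wt n g' a = wt n g (\<phi> a)" for a
    proof (cases "a = 0")
      case False
      then have "int (wt n g' a) = int (wt n g (\<phi> a))"
        using g g' GL4_eq_0_iff[OF \<phi>(2), of a] \<phi>(1,3,4) unfolding has_weights_def by simp
      then show ?thesis by simp
    qed (simp add: GL4_eq_0_iff[OF \<phi>(2), of 0, THEN iffD2])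
    then show "(code n g, code n g') \<in> code_equiv n 4"
      using wt_imp_code_equiv[OF \<phi>(2) _ inj] g g' unfolding has_weights_def by blast
  qed
qed

text \<open>Every LCD code without zero columns and with minimum weight at least \<open>D\<close> arises from a normal form and a
distribution.\<close>

lemma weights_in_normal_form:
  assumes g: "nondegenerate_gram n g" "\<And>i. i < n \<Longrightarrow> g i \<noteq> 0" "\<And>a. a \<noteq> 0 \<Longrightarrow> D \<le> wt n g a"
    and n: "8 * int n = 15 * int D + E"
  shows "\<exists>p\<in>set normal_forms. residue_sum (int D) p \<le> E \<and>
    (\<exists>f\<in>distributions (nat ((E - residue_sum (int D) p) div 4)). \<exists>\<phi>\<in>GL4. \<forall>a. a \<noteq> 0 \<longrightarrow>
      int (wt n g (\<phi> a)) = int D + (form p a - int D) mod 4 + 4 * int (f a))"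
proof -
  interpret nondegenerate_form "\<lambda>a. int (wt n g a)" "gram n g" by (rule nondegenerate_form_wt[OF g(1)])
  obtain p \<phi> where p: "p \<in> set normal_forms" "\<phi> \<in> GL4" "\<And>a. int (wt n g (\<phi> a)) mod 4 = form p a"
    using normal_form by blast
  have "bij \<phi>" and \<phi>_0: "\<phi> 0 = 0" using p(2) GL4_eq_0_iff[OF p(2), of 0] by (simp_all add: GL4_def)
  define f where "f a = (if a = 0 then 0 else (wt n g (\<phi> a) - D) div 4)" for a
  have wt_f: "int (wt n g (\<phi> a)) = int D + (form p a - int D) mod 4 + 4 * int (f a)" if "a \<noteq> 0" for a
  proof -
    have le: "D \<le> wt n g (\<phi> a)" using g(3) GL4_eq_0_iff[OF p(2)] that by simp
    then have "int (f a) = (int (wt n g (\<phi> a)) - int D) div 4"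
      using that by (simp add: f_def zdiv_int of_nat_diff)
    then show ?thesis using mod_4_decompose[of "int D" "int (wt n g (\<phi> a))" "form p a"] le p(3) by simp
  qed
  have "8 * int n = (\<Sum>a\<in>-{0}. int (wt n g (\<phi> a)))"
  proof -
    have "{i. i < n \<and> g i \<noteq> 0} = {..<n}" using g(2) by auto
    then have "8 * int n = (\<Sum>a\<in>UNIV. int (wt n g a))" by (simp add: sum_wt)
    also have "\<dots> = (\<Sum>a\<in>UNIV. int (wt n g (\<phi> a)))" using \<open>bij \<phi>\<close> by (rule sum.reindex_bij_betw[symmetric])
    also have "\<dots> = (\<Sum>a\<in>-{0}. int (wt n g (\<phi> a)))" by (rule sum_nonzero) (simp add: \<phi>_0)
    finally show ?thesis .
  qed
  also have "\<dots> = (\<Sum>a\<in>-{0}. int D + (form p a - int D) mod 4 + 4 * int (f a))"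
    by (rule sum.cong) (simp_all add: wt_f)
  also have "\<dots> = 15 * int D + residue_sum (int D) p + 4 * (\<Sum>a\<in>-{0}. int (f a))"
    by (simp add: sum.distrib card_Compl_0 residue_sum_eq flip: sum_distrib_left)
  also have "(\<Sum>a\<in>-{0}. int (f a)) = int (\<Sum>a\<in>UNIV. f a)"
    using sum_nonzero[of f] by (simp add: f_def[of 0])
  finally have E: "E = residue_sum (int D) p + 4 * int (\<Sum>a\<in>UNIV. f a)" using n by linarith
  then have "f \<in> distributions (nat ((E - residue_sum (int D) p) div 4))"
    by (simp add: distributions_def f_def[of 0] del: of_nat_sum)
  moreover have "residue_sum (int D) p \<le> E" using E of_nat_0_le_iff[of "\<Sum>a\<in>UNIV. f a"] by linarith
  ultimately show ?thesis using p(1,2) wt_f by blast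
qed

section \<open>Counting the classes\<close>

lemma LCD_code_4_iff:
  "LCD_code n 4 d C \<longleftrightarrow> (\<exists>g. C = code n g \<and> nondegenerate_gram n g \<and> Min (wt n g ` (- {0})) = d)"
proof
  assume "LCD_code n 4 d C"
  then have C: "binary_code n 4 C" "min_weight n C = d" "LCD n C" by (auto simp: LCD_code_def)
  obtain g where g: "C = code n g" "inj (codeword n g)" using C(1) unfolding binary_code_4_iff by blast
  have "nondegenerate_gram n g" using C(3) LCD_code_iff[OF g(2)] unfolding g(1) by blast
  moreover have "Min (wt n g ` (- {0})) = d" using C(2) min_weight_code[OF g(2)] unfolding g(1) by simp
  ultimately show "\<exists>g. C = code n g \<and> nondegenerate_gram n g \<and> Min (wt n g ` (- {0})) = d" using g(1) by blast
next
  assume "\<exists>g. C = code n g \<and> nondegenerate_gram n g \<and> Min (wt n g ` (- {0})) = d"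
  then obtain g where g: "C = code n g" "nondegenerate_gram n g" "Min (wt n g ` (- {0})) = d" by blast
  note inj = inj_codeword_if_nondegenerate[OF g(2)]
  show "LCD_code n 4 d C"
    unfolding LCD_code_def g(1) using inj binary_code_4_iff LCD_code_iff[OF inj] min_weight_code[OF inj] g(2,3) by blast
qed

lemma Min_wt_ge_iff: "D \<le> Min (wt n g ` (- {0})) \<longleftrightarrow> (\<forall>a. a \<noteq> 0 \<longrightarrow> D \<le> wt n g a)"
proof -
  have "(1,0,0,0) \<in> - {0 :: pt}" by (simp add: zero_prod_def)
  then have "wt n g ` (- {0}) \<noteq> {}" by blast
  then show ?thesis by (simp add: Min_ge_iff) blast
qed

lemma residue_sum_mod: "residue_sum (d mod 4 + j) p = residue_sum (d + j) p"
  unfolding residue_sum_def by (rule arg_cong[where f = sum_list], rule map_cong) (simp_all, metis mod_add_left_eq mod_diff_right_eq)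

text \<open>Classes of codes and orbits of distributions are compared through the equality of classes and of orbits.\<close>

lemma card_image_eq_if_same_kernel:
  assumes "\<And>x y. x \<in> A \<Longrightarrow> y \<in> A \<Longrightarrow> f x = f y \<longleftrightarrow> g x = g y"
  shows "card (f ` A) = card (g ` A)"
proof -
  have "bij_betw (\<lambda>X. g (SOME x. x \<in> A \<and> f x = X)) (f ` A) (g ` A)"
  proof (rule bij_betwI')
    have some: "(SOME x. x \<in> A \<and> f x = X) \<in> A \<and> f (SOME x. x \<in> A \<and> f x = X) = X" if "X \<in> f ` A" for X
      by (rule someI_ex) (use that in blast)
    show "(g (SOME x. x \<in> A \<and> f x = X) = g (SOME x. x \<in> A \<and> f x = Y)) = (X = Y)" if "X \<in> f ` A" "Y \<in> f ` A" for X Y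
      using some[OF that(1)] some[OF that(2)] assms by metis
    show "g (SOME x. x \<in> A \<and> f x = X) \<in> g ` A" if "X \<in> f ` A" for X using some[OF that] by blast
    show "\<exists>X\<in>f ` A. Y = g (SOME x. x \<in> A \<and> f x = X)" if Y: "Y \<in> g ` A" for Y
    proof -
      obtain y where y: "y \<in> A" "Y = g y" using Y by blast
      then have "g (SOME x. x \<in> A \<and> f x = f y) = g y" using some[of "f y"] assms by blast
      then show ?thesis using y by (intro bexI[of _ "f y"]) simp_all
    qed
  qed
  then show ?thesis by (rule bij_betw_same_card)
qed

lemma isometry_group_left_coset:
  assumes "\<phi> \<in> isometry_group p" shows "(\<lambda>\<psi>. \<phi> o \<psi>) ` isometry_group p = isometry_group p"
proof (intro subset_antisym subsetI)
  fix \<psi> assume "\<psi> \<in> isometry_group p"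
  then have "inv_into UNIV \<phi> o \<psi> \<in> isometry_group p"
    by (rule isometry_group_comp[OF isometry_group_inv(1)[OF assms]])
  moreover have "\<psi> = \<phi> o (inv_into UNIV \<phi> o \<psi>)"
    unfolding o_assoc isometry_group_inv(2)[OF assms] by simp
  ultimately show "\<psi> \<in> (\<lambda>\<psi>. \<phi> o \<psi>) ` isometry_group p" by blast
qed (use isometry_group_comp[OF assms] in blast)

lemma hyperplane_ok_imp:
  assumes "hyperplane_ok E (int D mod 4) D0 p x" "D0 \<le> int D"
  shows "E \<le> 2 * (\<Sum>a\<in>-{0}. of_bool (dot a x = 1) * ((form p a - int D) mod 4)) + int D"
  using assms unfolding hyperplane_ok_def sum_list_nonzero_points by (simp only: mod_diff_right_eq)

text \<open>One code is chosen for each normal form and each distribution. These codes are optimal, every optimal code without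
zero columns is equivalent to one of them, and two of them are equivalent if and only if the normal
forms agree and the distributions lie in one orbit of the isometry group.\<close>

theorem num_optimal_LCD_eq_class_total:
  assumes "n > 4" and n: "8 * int n = 15 * int D + E" and c: "c = int D mod 4"
    and ok: "parameters_ok E c D0" and D0: "D0 \<le> int D"
  shows "int (num_optimal_LCD n 4) = class_total E c"
proof -
  define S where "S = {C. optimal_LCD_code n 4 C \<and> dual_distance n C \<ge> 2}"
  define R where "R = code_equiv n 4"
  define P where "P = {p \<in> set normal_forms. residue_sum (int D) p \<le> E}"
  define K where "K p = nat ((E - residue_sum (int D) p) div 4)" for p
  define G where "G p f = (SOME g. has_weights n D p f g)" for p f
  have res: "residue_sum c p = residue_sum (int D) p" "residue_sum (c + 1) p = residue_sum (int D + 1) p" for p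
    unfolding c using residue_sum_mod[of "int D" 0] residue_sum_mod[of "int D" 1] by simp_all
  have upper: "E < residue_sum (int D + 1) p + 15" if "p \<in> set normal_forms" for p
    using ok that by (simp add: parameters_ok_def list_all_iff form_ok_def res)
  have G: "has_weights n D p f (G p f)" if p: "p \<in> P" and f: "f \<in> distributions (K p)" for p f
  proof -
    have form_ok: "form_ok E c D0 p" and p': "p \<in> set normal_forms" and le: "residue_sum (int D) p \<le> E"
      using ok p by (auto simp: parameters_ok_def list_all_iff P_def)
    have "(E - residue_sum (int D) p) mod 4 = 0" using form_ok le by (simp add: form_ok_def res)
    then have "4 * ((E - residue_sum (int D) p) div 4) = E - residue_sum (int D) p" by auto
    moreover have "0 \<le> (E - residue_sum (int D) p) div 4" using le by (simp add: pos_imp_zdiv_nonneg_iff)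
    ultimately have "residue_sum (int D) p + 4 * int (K p) = E" by (simp add: K_def)
    moreover have "hyperplane_ok E c D0 p x" if "x \<noteq> 0" for x
      using form_ok le that by (simp add: form_ok_def res list_all_iff set_nonzero_points)
    ultimately have "\<exists>g. has_weights n D p f g"
      using exists_columns_with_weights[OF p' f n] hyperplane_ok_imp[OF _ D0] unfolding c by blast
    then show ?thesis unfolding G_def by (rule someI_ex)
  qed
  have Min_le: "Min (wt n g ` (- {0})) \<le> D" if "nondegenerate_gram n g" for g
  proof (rule ccontr)
    assume "\<not> ?thesis"
    then have "D < wt n g a" if "a \<noteq> 0" for a using Min_wt_ge_iff[of "Suc D" n g] that by (simp add: Suc_le_eq)
    then obtain p where p: "p \<in> set normal_forms" "residue_sum (int D + 1) p + 15 \<le> E"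
      using no_larger_minimum_weight[OF \<open>nondegenerate_gram n g\<close> _ n] by blast
    then show False using upper[OF p(1)] by linarith
  qed
  have rep: "nondegenerate_gram n (G p f)" "\<And>i. i < n \<Longrightarrow> G p f i \<noteq> 0" "Min (wt n (G p f) ` (- {0})) = D"
    if p: "p \<in> P" and f: "f \<in> distributions (K p)" for p f
  proof -
    note hw = G[OF p f]
    show nd: "nondegenerate_gram n (G p f)" using has_weights_nondegenerate[OF hw] p by (simp add: P_def)
    show "G p f i \<noteq> 0" if "i < n" for i using hw that unfolding has_weights_def by blast
    have "D \<le> wt n (G p f) a" if "a \<noteq> 0" for a
    proof -
      have "int (wt n (G p f) a) = int D + (form p a - int D) mod 4 + 4 * int (f a)"
        using hw that unfolding has_weights_def by blast
      moreover have "0 \<le> (form p a - int D) mod 4" by simp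
      ultimately show ?thesis by linarith
    qed
    then have "D \<le> Min (wt n (G p f) ` (- {0}))" unfolding Min_wt_ge_iff by blast
    then show "Min (wt n (G p f) ` (- {0})) = D" using Min_le[OF nd] by simp
  qed
  have d2: "d2 n 4 = D"
    unfolding d2_def
  proof (rule Max_eqI)
    have le: "d \<le> D" if "\<exists>C. LCD_code n 4 d C" for d using that Min_le unfolding LCD_code_4_iff by blast
    show "finite {d. \<exists>C. LCD_code n 4 d C}"
      by (rule finite_subset[of _ "{..D}"], intro subsetI, unfold mem_Collect_eq atMost_iff, rule le) simp_all
    show "d \<le> D" if "d \<in> {d. \<exists>C. LCD_code n 4 d C}" for d by (rule le[OF that[unfolded mem_Collect_eq]])
    obtain p where p: "p \<in> P"
      using ok unfolding parameters_ok_def list_ex_iff P_def res by blast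
    have "(\<lambda>a. if a = (1,0,0,0) then K p else 0) \<in> distributions (K p)"
      by (simp add: distributions_def zero_prod_def)
    from rep[OF p this] show "D \<in> {d. \<exists>C. LCD_code n 4 d C}" unfolding LCD_code_4_iff by blast
  qed
  have S_iff: "C \<in> S \<longleftrightarrow> (\<exists>g. C = code n g \<and> nondegenerate_gram n g \<and> Min (wt n g ` (- {0})) = D \<and> (\<forall>i<n. g i \<noteq> 0))" for C
  proof
    assume "C \<in> S"
    then have C: "LCD_code n 4 D C" "dual_distance n C \<ge> 2" by (simp_all add: S_def optimal_LCD_code_def d2)
    obtain g where g: "C = code n g" "nondegenerate_gram n g" "Min (wt n g ` (- {0})) = D"
      using C(1) unfolding LCD_code_4_iff by blast
    have "\<forall>i<n. g i \<noteq> 0" using C(2) dual_distance_ge_2_iff[OF assms(1)] unfolding g(1) by blast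
    then show "\<exists>g. C = code n g \<and> nondegenerate_gram n g \<and> Min (wt n g ` (- {0})) = D \<and> (\<forall>i<n. g i \<noteq> 0)"
      using g by blast
  next
    assume "\<exists>g. C = code n g \<and> nondegenerate_gram n g \<and> Min (wt n g ` (- {0})) = D \<and> (\<forall>i<n. g i \<noteq> 0)"
    then obtain g where g: "C = code n g" "nondegenerate_gram n g" "Min (wt n g ` (- {0})) = D" "\<forall>i<n. g i \<noteq> 0" by blast
    have "LCD_code n 4 D C" unfolding LCD_code_4_iff using g(1-3) by blast
    moreover have "dual_distance n C \<ge> 2" using g(4) unfolding g(1) dual_distance_ge_2_iff[OF assms(1)] .
    ultimately show "C \<in> S" by (simp add: S_def optimal_LCD_code_def d2)
  qed
  have R_class: "R `` {C} = R `` {C'} \<longleftrightarrow> (C, C') \<in> R" if "binary_code n 4 C" "binary_code n 4 C'" for C C'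
    unfolding R_def by (rule eq_equiv_class_iff[OF equiv_code_equiv]) (use that in simp_all)
  have binary: "binary_code n 4 (code n g)" if "nondegenerate_gram n g" for g
    using inj_codeword_if_nondegenerate[OF that] unfolding binary_code_4_iff by blast
  have f_0: "f 0 = 0" if "f \<in> distributions k" for f k using that by (simp add: distributions_def)
  have same_class: "R `` {code n (G p f)} = R `` {code n (G p' f')} \<longleftrightarrow> p = p' \<and> (\<exists>\<phi>\<in>isometry_group p. f' = f o \<phi>)"
    if "p \<in> P" "p' \<in> P" "f \<in> distributions (K p)" "f' \<in> distributions (K p')" for p p' f f'
  proof -
    have p: "p \<in> set normal_forms" "p' \<in> set normal_forms" using that by (simp_all add: P_def)
    have "R `` {code n (G p f)} = R `` {code n (G p' f')} \<longleftrightarrow> (code n (G p f), code n (G p' f')) \<in> R"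
      by (rule R_class[OF binary[OF rep(1)[OF that(1,3)]] binary[OF rep(1)[OF that(2,4)]]])
    also have "\<dots> \<longleftrightarrow> p = p' \<and> (\<exists>\<phi>\<in>isometry_group p. f' = f o \<phi>)"
      unfolding R_def by (rule equivalent_iff_isometric[OF G[OF that(1,3)] G[OF that(2,4)] p f_0[OF that(3)] f_0[OF that(4)]])
    finally show ?thesis .
  qed
  have every_class: "\<exists>p\<in>P. \<exists>f\<in>distributions (K p). R `` {C} = R `` {code n (G p f)}" if "C \<in> S" for C
  proof -
    obtain g where g: "C = code n g" "nondegenerate_gram n g" "Min (wt n g ` (- {0})) = D" "\<And>i. i < n \<Longrightarrow> g i \<noteq> 0"
      using \<open>C \<in> S\<close> unfolding S_iff by blast
    have D_le: "D \<le> wt n g a" if "a \<noteq> 0" for a using Min_wt_ge_iff[of D n g] g(3) that by simp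
    obtain p f \<phi> where p: "p \<in> set normal_forms" "residue_sum (int D) p \<le> E" and f: "f \<in> distributions (K p)"
      and \<phi>: "\<phi> \<in> GL4" "\<And>a. a \<noteq> 0 \<Longrightarrow> int (wt n g (\<phi> a)) = int D + (form p a - int D) mod 4 + 4 * int (f a)"
      using weights_in_normal_form[OF g(2,4) D_le n] unfolding K_def by blast
    have "p \<in> P" using p by (simp add: P_def)
    note hw = G[OF this f] and nd = rep(1,2)[OF this f]
    have "wt n (G p f) a = wt n g (\<phi> a)" for a
    proof (cases "a = 0")
      case True
      then show ?thesis using GL4_eq_0_iff[OF \<phi>(1), of 0] by simp
    next
      case False
      then have "int (wt n (G p f) a) = int (wt n g (\<phi> a))" using hw \<phi>(2) unfolding has_weights_def by simp
      then show ?thesis by simp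
    qed
    then have "(C, code n (G p f)) \<in> R"
      unfolding R_def g(1)
      using wt_imp_code_equiv[OF \<phi>(1), of n "G p f" g] inj_codeword_if_nondegenerate g(2,4) nd by blast
    then have "R `` {C} = R `` {code n (G p f)}"
      using R_class binary g(1,2) nd(1) by blast
    then show ?thesis using \<open>p \<in> P\<close> f by blast
  qed
  have "S // R = (\<Union>p\<in>P. (\<lambda>f. R `` {code n (G p f)}) ` distributions (K p))"
  proof (intro subset_antisym subsetI)
    fix X assume "X \<in> S // R"
    then obtain C where "C \<in> S" "X = R `` {C}" by (auto simp: quotient_def)
    then show "X \<in> (\<Union>p\<in>P. (\<lambda>f. R `` {code n (G p f)}) ` distributions (K p))" using every_class[of C] by blast
  next
    fix X assume "X \<in> (\<Union>p\<in>P. (\<lambda>f. R `` {code n (G p f)}) ` distributions (K p))"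
    then obtain p f where pf: "p \<in> P" "f \<in> distributions (K p)" "X = R `` {code n (G p f)}" by blast
    have "code n (G p f) \<in> S" unfolding S_iff using rep[OF pf(1,2)] by blast
    then show "X \<in> S // R" unfolding pf(3) by (rule quotientI)
  qed
  then have "card (S // R) = (\<Sum>p\<in>P. card ((\<lambda>f. R `` {code n (G p f)}) ` distributions (K p)))"
    using same_class by (simp only:) (rule card_UN_disjoint, auto simp: P_def finite_distributions)
  also have "\<dots> = (\<Sum>p\<in>P. card (orbits_under (isometry_group p) (distributions (K p))))"
  proof (rule sum.cong)
    fix p assume p: "p \<in> P"
    have "card ((\<lambda>f. R `` {code n (G p f)}) ` distributions (K p)) = card ((\<lambda>f. (\<lambda>\<phi>. f o \<phi>) ` isometry_group p) ` distributions (K p))"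
    proof (rule card_image_eq_if_same_kernel)
      fix f f' assume f: "f \<in> distributions (K p)" "f' \<in> distributions (K p)"
      have id: "id \<in> isometry_group p" by (simp add: isometry_group_def GL4_id)
      have "(\<lambda>\<phi>. f o \<phi>) ` isometry_group p = (\<lambda>\<phi>. f' o \<phi>) ` isometry_group p \<longleftrightarrow> (\<exists>\<phi>\<in>isometry_group p. f' = f o \<phi>)"
      proof
        assume "(\<lambda>\<phi>. f o \<phi>) ` isometry_group p = (\<lambda>\<phi>. f' o \<phi>) ` isometry_group p"
        moreover have "f' \<in> (\<lambda>\<phi>. f' o \<phi>) ` isometry_group p" using id by (metis comp_id imageI)
        ultimately show "\<exists>\<phi>\<in>isometry_group p. f' = f o \<phi>" by blast
      next
        assume "\<exists>\<phi>\<in>isometry_group p. f' = f o \<phi>"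
        then obtain \<phi> where \<phi>: "\<phi> \<in> isometry_group p" "f' = f o \<phi>" by blast
        have "(\<lambda>\<psi>. \<phi> o \<psi>) ` isometry_group p = isometry_group p" by (rule isometry_group_left_coset[OF \<phi>(1)])
        then have "(\<lambda>\<phi>. f o \<phi>) ` isometry_group p = (\<lambda>\<phi>. f o \<phi>) ` (\<lambda>\<psi>. \<phi> o \<psi>) ` isometry_group p" by simp
        then show "(\<lambda>\<phi>. f o \<phi>) ` isometry_group p = (\<lambda>\<phi>. f' o \<phi>) ` isometry_group p"
          by (simp add: image_image \<phi>(2) o_assoc)
      qed
      then show "(R `` {code n (G p f)} = R `` {code n (G p f')}) =
          ((\<lambda>\<phi>. f o \<phi>) ` isometry_group p = (\<lambda>\<phi>. f' o \<phi>) ` isometry_group p)"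
        using same_class[OF p p f] by blast
    qed
    then show "card ((\<lambda>f. R `` {code n (G p f)}) ` distributions (K p)) = card (orbits_under (isometry_group p) (distributions (K p)))"
      by (simp only: orbits_under_def)
  qed simp
  finally have card: "int (card (S // R)) = (\<Sum>p\<in>P. int (card (orbits_under (isometry_group p) (distributions (K p)))))"
    by simp
  define h where "h p = (if residue_sum (int D) p \<le> E then int (card (orbits_under (isometry_group p) (distributions (K p)))) else 0)" for p
  have "contribution E c x = h (fst x)" if "x \<in> set cycle_table" for x
  proof -
    obtain p T where x: "x = (p, T)" by (cases x)
    have "table_ok (p, T)" using cycle_table_ok that unfolding x list_all_iff by blast
    then show ?thesis unfolding x contribution_def h_def prod.case fst_conv res K_def
      by (simp only: card_orbits_distributions)
  qed
  then have "class_total E c = sum_list (map (\<lambda>x. h (fst x)) cycle_table)"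
    unfolding class_total_def by (simp cong: map_cong)
  also have "\<dots> = sum_list (map h normal_forms)"
    by (simp add: cycle_table_def normal_forms_def)
  also have "\<dots> = (\<Sum>p\<in>set normal_forms. h p)"
    by (rule sum_list_distinct_conv_sum_set) (simp add: normal_forms_def)
  also have "\<dots> = (\<Sum>p\<in>P. int (card (orbits_under (isometry_group p) (distributions (K p)))))"
    unfolding P_def h_def by (rule sum.mono_neutral_cong_right) auto
  finally show ?thesis using card unfolding num_optimal_LCD_def S_def R_def by simp
qed

text \<open>Increasing \<open>s\<close> by 1 increases the length by 15 and the optimal minimum weight by 8; \<open>D0\<close> is the minimum weight at the least
admissible \<open>s0\<close>, where the multiplicities of columns are smallest.\<close>

lemma num_optimal_LCD_family:
  assumes "parameters_ok E c d" and "class_total E c = int N" and d: "d = int D0" "c = int D0 mod 4"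
    and n: "8 * int (15 * s0 + t) = 15 * int D0 + E" "15 * s0 + t > 4" and s: "s0 \<le> s"
  shows "num_optimal_LCD (15 * s + t) 4 = N"
proof -
  obtain r where r: "s = s0 + r" using s le_iff_add by blast
  have "int (num_optimal_LCD (15 * s + t) 4) = class_total E c"
  proof (rule num_optimal_LCD_eq_class_total[OF _ _ _ assms(1)])
    show "8 * int (15 * s + t) = 15 * int (D0 + 8 * r) + E" using n(1) by (simp add: r algebra_simps)
    show "15 * s + t > 4" using n(2) by (simp add: r)
    show "c = int (D0 + 8 * r) mod 4" unfolding d(2) by presburger
    show "d \<le> int (D0 + 8 * r)" by (simp add: d(1))
  qed
  then show ?thesis using assms(2) by simp
qed

text \<open>Below, \<open>E\<close>, the residue of \<open>D\<close> modulo 4 and the least \<open>D\<close> are given for each residue \<open>t\<close> of \<open>n\<close> modulo 15,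
where \<open>D\<close> is the integral part of \<open>8 * n / 15\<close> for \<open>t\<close> in \<open>{5, 9, 13}\<close>, two less for \<open>t = 0\<close>, and one less
otherwise.\<close>

lemma parameters_0: "parameters_ok 30 2 22" "class_total 30 2 = int 404"
  by code_simp+

lemma residue_class_0: "3 \<le> s \<Longrightarrow> num_optimal_LCD (15 * s) 4 = 404"
  using num_optimal_LCD_family[of 30 2 22 404 22 3 0 s, OF parameters_0] by simp

lemma parameters_1: "parameters_ok 23 3 15" "class_total 23 3 = int 10"
  by code_simp+

lemma residue_class_1: "2 \<le> s \<Longrightarrow> num_optimal_LCD (15 * s + 1) 4 = 10"
  by (rule num_optimal_LCD_family[of _ _ _ _ 15 2, OF parameters_1]) simp_all

lemma parameters_2: "parameters_ok 16 0 8" "class_total 16 0 = int 2"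
  by code_simp+

lemma residue_class_2: "1 \<le> s \<Longrightarrow> num_optimal_LCD (15 * s + 2) 4 = 2"
  by (rule num_optimal_LCD_family[of _ _ _ _ 8 1, OF parameters_2]) simp_all

lemma parameters_3: "parameters_ok 24 0 16" "class_total 24 0 = int 39"
  by code_simp+

lemma residue_class_3: "2 \<le> s \<Longrightarrow> num_optimal_LCD (15 * s + 3) 4 = 39"
  by (rule num_optimal_LCD_family[of _ _ _ _ 16 2, OF parameters_3]) simp_all

lemma parameters_4: "parameters_ok 17 1 9" "class_total 17 1 = int 2"
  by code_simp+

lemma residue_class_4: "1 \<le> s \<Longrightarrow> num_optimal_LCD (15 * s + 4) 4 = 2"
  by (rule num_optimal_LCD_family[of _ _ _ _ 9 1, OF parameters_4]) simp_all

lemma parameters_5: "parameters_ok 10 2 18" "class_total 10 2 = int 1"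
  by code_simp+

lemma residue_class_5: "2 \<le> s \<Longrightarrow> num_optimal_LCD (15 * s + 5) 4 = 1"
  by (rule num_optimal_LCD_family[of _ _ _ _ 18 2, OF parameters_5]) simp_all

lemma parameters_6: "parameters_ok 18 2 10" "class_total 18 2 = int 10"
  by code_simp+

lemma residue_class_6: "1 \<le> s \<Longrightarrow> num_optimal_LCD (15 * s + 6) 4 = 10"
  by (rule num_optimal_LCD_family[of _ _ _ _ 10 1, OF parameters_6]) simp_all

lemma parameters_7: "parameters_ok 26 2 18" "class_total 26 2 = int 121"
  by code_simp+

lemma residue_class_7: "2 \<le> s \<Longrightarrow> num_optimal_LCD (15 * s + 7) 4 = 121"
  by (rule num_optimal_LCD_family[of _ _ _ _ 18 2, OF parameters_7]) simp_all

lemma parameters_8: "parameters_ok 19 3 11" "class_total 19 3 = int 2"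
  by code_simp+

lemma residue_class_8: "1 \<le> s \<Longrightarrow> num_optimal_LCD (15 * s + 8) 4 = 2"
  by (rule num_optimal_LCD_family[of _ _ _ _ 11 1, OF parameters_8]) simp_all

lemma parameters_9: "parameters_ok 12 0 20" "class_total 12 0 = int 1"
  by code_simp+

lemma residue_class_9: "2 \<le> s \<Longrightarrow> num_optimal_LCD (15 * s + 9) 4 = 1"
  by (rule num_optimal_LCD_family[of _ _ _ _ 20 2, OF parameters_9]) simp_all

lemma parameters_10: "parameters_ok 20 0 12" "class_total 20 0 = int 11"
  by code_simp+

lemma residue_class_10: "1 \<le> s \<Longrightarrow> num_optimal_LCD (15 * s + 10) 4 = 11"
  by (rule num_optimal_LCD_family[of _ _ _ _ 12 1, OF parameters_10]) simp_all

lemma parameters_11: "parameters_ok 28 0 20" "class_total 28 0 = int 151"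
  by code_simp+

lemma residue_class_11: "2 \<le> s \<Longrightarrow> num_optimal_LCD (15 * s + 11) 4 = 151"
  by (rule num_optimal_LCD_family[of _ _ _ _ 20 2, OF parameters_11]) simp_all

lemma parameters_12: "parameters_ok 21 1 13" "class_total 21 1 = int 9"
  by code_simp+

lemma residue_class_12: "1 \<le> s \<Longrightarrow> num_optimal_LCD (15 * s + 12) 4 = 9"
  by (rule num_optimal_LCD_family[of _ _ _ _ 13 1, OF parameters_12]) simp_all

lemma parameters_13: "parameters_ok 14 2 6" "class_total 14 2 = int 2"
  by code_simp+

lemma residue_class_13: "0 \<le> s \<Longrightarrow> num_optimal_LCD (15 * s + 13) 4 = 2"
  by (rule num_optimal_LCD_family[of _ _ _ _ 6 0, OF parameters_13]) simp_all

lemma parameters_14: "parameters_ok 22 2 14" "class_total 22 2 = int 33"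
  by code_simp+

lemma residue_class_14: "1 \<le> s \<Longrightarrow> num_optimal_LCD (15 * s + 14) 4 = 33"
  by (rule num_optimal_LCD_family[of _ _ _ _ 14 1, OF parameters_14]) simp_all



theorem proposition6p7:
  shows
    "(\<forall>s\<ge>3. num_optimal_LCD (15 * s) 4 = 404) \<and>
     (\<forall>t\<in>{1, 6}. \<forall>s\<ge>(if t = 1 then 2 else 1). num_optimal_LCD (15 * s + t) 4 = 10) \<and>
     (\<forall>t\<in>{2, 4, 8, 13}. \<forall>s\<ge>(if t = 13 then 0 else 1). num_optimal_LCD (15 * s + t) 4 = 2) \<and>
     (\<forall>s\<ge>2. num_optimal_LCD (15 * s + 3) 4 = 39) \<and>
     (\<forall>t\<in>{5, 9}. \<forall>s\<ge>2. num_optimal_LCD (15 * s + t) 4 = 1) \<and>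
     (\<forall>s\<ge>2. num_optimal_LCD (15 * s + 7) 4 = 121) \<and>
     (\<forall>s\<ge>1. num_optimal_LCD (15 * s + 10) 4 = 11) \<and>
     (\<forall>s\<ge>2. num_optimal_LCD (15 * s + 11) 4 = 151) \<and>
     (\<forall>s\<ge>1. num_optimal_LCD (15 * s + 12) 4 = 9) \<and>
     (\<forall>s\<ge>1. num_optimal_LCD (15 * s + 14) 4 = 33)"
  using residue_class_0 residue_class_1 residue_class_2 residue_class_3 residue_class_4
    residue_class_5 residue_class_6 residue_class_7 residue_class_8 residue_class_9 residue_class_10
    residue_class_11 residue_class_12 residue_class_13 residue_class_14 by simp

end
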